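(* Let $D$ be an integral domain that is not a field, let $X$ be an indeterminate over $D$ and let $R=D[X]$. (1) Let $P$ be any one of the properties: "is a proper nonzero principal ideal", "is a proper nonzero $t$-invertible $t$-ideal", "is a proper nonzero $t$-ideal", "is a proper nonzero $t$-ideal of finite type", "is a proper nonzero divisorial ideal". If $I(D)\vartriangleleft P$, then $I(R)\vartriangleleft P$ does not hold. (2) Let $P$ be any one of the properties: "is a $t$-invertible $t$-ideal", "is a $t$-ideal of finite type", "is a divisorial ideal". Then $I_t(D)\vartriangleleft P$ if and only if $I_t(R)\vartriangleleft P$.
   Context: For an integral domain $A$ with quotient field $F$ and a nonzero fractional ideal $I$ of $A$: $I^{-1}=\{x\in F: xI\subseteq A\}$, $I_v=(I^{-1})^{-1}$, and $I_t=\bigcup\{J_v: J\subseteq I \text{ a nonzero finitely generated ideal}\}$. $I$ is divisorial if $I=I_v$, a $t$-ideal if $I=I_t$, a $t$-ideal of finite type if $I=J_t$ for some nonzero finitely generated $J$, and $t$-invertible if $(II^{-1})_t=A$. $I(A)$ is the set of nonzero proper integral ideals of $A$, and $I_t(A)$ is the set of (nonzero) proper integral $t$-ideals of $A$. For $S(A)=I(A)$ or $I_t(A)$ and a property $P$ of ideals, $S(A)\vartriangleleft P$ means that every $s\in S(A)$ is contained in some $\gamma\in S(A)$ satisfying $P$. *)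

theory Defs
  imports "HOL-Computational_Algebra.Polynomial_Factorial"
begin

text \<open>
  The integral domain is a type \<open>'a\<close> of class \<open>idom\<close>, its quotient field is \<open>'a fract\<close>,
  and all ideals (integral ones included) are sets of elements of the quotient field;
  \<open>base_ring\<close> is the domain itself, seen inside its quotient field.
\<close>

abbreviation base_ring :: "'a::idom fract set" where
  "base_ring \<equiv> range to_fract"

global_interpretation fract: module "\<lambda>(a::'a::idom) (x::'a fract). to_fract a * x"
  by unfold_locales (simp_all add: algebra_simps)

text \<open>
  Thus \<open>fract.subspace I\<close> says that \<open>I\<close> is an \<open>'a\<close>-submodule of the quotient field, and
  \<open>fract.span S\<close> is the \<open>'a\<close>-submodule generated by \<open>S\<close>.
\<close>

definition fractional_ideal :: "'a::idom fract set \<Rightarrow> bool" where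
  "fractional_ideal I \<longleftrightarrow>
     fract.subspace I \<and> (\<exists>d. d \<noteq> 0 \<and> (\<forall>x\<in>I. to_fract d * x \<in> base_ring))"

definition proper_nonzero :: "'a::idom fract set \<Rightarrow> bool" where
  "proper_nonzero I \<longleftrightarrow> I \<noteq> {0} \<and> I \<noteq> base_ring"

definition ideal_prod :: "'a::idom fract set \<Rightarrow> 'a fract set \<Rightarrow> 'a fract set" where
  "ideal_prod I J = fract.span {x * y |x y. x \<in> I \<and> y \<in> J}"

definition ideal_inv :: "'a::idom fract set \<Rightarrow> 'a fract set" where
  "ideal_inv I = {x. \<forall>y\<in>I. x * y \<in> base_ring}"

definition v_closure :: "'a::idom fract set \<Rightarrow> 'a fract set" where
  "v_closure I = ideal_inv (ideal_inv I)"

definition fg_nonzero :: "'a::idom fract set \<Rightarrow> bool" where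
  "fg_nonzero J \<longleftrightarrow> J \<noteq> {0} \<and> (\<exists>S. finite S \<and> J = fract.span S)"

definition t_closure :: "'a::idom fract set \<Rightarrow> 'a fract set" where
  "t_closure I = \<Union> {v_closure J |J. fg_nonzero J \<and> J \<subseteq> I}"

definition principal_ideal :: "'a::idom fract set \<Rightarrow> bool" where
  "principal_ideal I \<longleftrightarrow> (\<exists>a. I = fract.span {a})"

definition divisorial :: "'a::idom fract set \<Rightarrow> bool" where
  "divisorial I \<longleftrightarrow> fractional_ideal I \<and> I \<noteq> {0} \<and> I = v_closure I"

definition t_ideal :: "'a::idom fract set \<Rightarrow> bool" where
  "t_ideal I \<longleftrightarrow> fractional_ideal I \<and> I \<noteq> {0} \<and> I = t_closure I"

definition finite_type_t_ideal :: "'a::idom fract set \<Rightarrow> bool" where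
  "finite_type_t_ideal I \<longleftrightarrow> (\<exists>J. fg_nonzero J \<and> I = t_closure J)"

definition t_invertible :: "'a::idom fract set \<Rightarrow> bool" where
  "t_invertible I \<longleftrightarrow>
     fractional_ideal I \<and> I \<noteq> {0} \<and> t_closure (ideal_prod I (ideal_inv I)) = base_ring"

definition proper_ideals :: "'a::idom fract set set" where
  "proper_ideals = {I. fractional_ideal I \<and> I \<subseteq> base_ring \<and> proper_nonzero I}"

definition proper_t_ideals :: "'a::idom fract set set" where
  "proper_t_ideals = {I \<in> proper_ideals. t_ideal I}"

definition every_contained_in :: "'b set set \<Rightarrow> ('b set \<Rightarrow> bool) \<Rightarrow> bool"
    (infix "\<lhd>" 50) where
  "S \<lhd> P \<longleftrightarrow> (\<forall>s\<in>S. \<exists>\<gamma>\<in>S. s \<subseteq> \<gamma> \<and> P \<gamma>)"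

end

theory Submission
  imports Defs
begin

text \<open>
  For (1), the ideal \<open>(a, X)\<close> with \<open>a\<close> a nonzero nonunit of \<open>D\<close> is proper, but its \<open>v\<close>-closure
  is \<open>R\<close>, whereas each property forces an ideal to contain the \<open>v\<close>-closures of its finite subsets.

  For (2), let \<open>Q\<close> be a proper \<open>t\<close>-ideal of \<open>R\<close> with content \<open>c(Q)\<close>. If \<open>c(Q)\<^sub>t \<noteq> D\<close>, then \<open>Q\<close> lies
  in the extended ideal \<open>c(Q)\<^sub>t[X]\<close>, and \<open>I \<mapsto> I[X]\<close> preserves and reflects all three properties
  on \<open>t\<close>-ideals. If \<open>c(Q)\<^sub>t = D\<close>, then \<open>Q\<close> has all three properties itself: \<open>Q = J\<^sub>v\<close>, where \<open>J\<close> is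
  generated by an element of minimal degree and finitely many elements whose coefficients have
  \<open>v\<close>-closure \<open>D\<close>. Conversely, a maximal \<open>t\<close>-ideal \<open>M\<close> of \<open>D\<close> extends to a maximal \<open>t\<close>-ideal
  \<open>M[X]\<close>, because the content of a proper \<open>t\<close>-ideal meeting \<open>D\<close> nontrivially has a proper
  \<open>t\<close>-closure. These facts rest on McCoy's argument applied to the \<open>D\<close>-module \<open>F / D\<close>.
\<close>

subsection \<open>The \<open>v\<close>- and \<open>t\<close>-operations\<close>

lemma to_fract_mult_in_base_ring: "x \<in> base_ring \<Longrightarrow> y \<in> base_ring \<Longrightarrow> x * y \<in> base_ring"
  by (auto simp flip: to_fract_mult)

lemma subspace_base_ring: "fract.subspace (base_ring :: 'a::idom fract set)"
proof (rule fract.subspaceI)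
  show "0 \<in> (base_ring :: 'a fract set)"
    by (auto simp flip: to_fract_0)
qed (auto simp flip: to_fract_add to_fract_mult)

lemma zero_in_base_ring [simp]: "0 \<in> (base_ring :: 'a::idom fract set)"
  by (rule fract.subspace_0[OF subspace_base_ring])

lemma one_in_base_ring [simp]: "1 \<in> (base_ring :: 'a::idom fract set)"
  by (auto simp flip: to_fract_1)

lemma subspace_ideal_inv: "fract.subspace (ideal_inv I)"
  unfolding ideal_inv_def
  by (rule fract.subspaceI)
    (auto simp: distrib_right mult.assoc intro: fract.subspace_add[OF subspace_base_ring]
       fract.subspace_scale[OF subspace_base_ring])

lemma subspace_v_closure: "fract.subspace (v_closure I)"
  unfolding v_closure_def by (rule subspace_ideal_inv)

lemma ideal_inv_antimono: "I \<subseteq> J \<Longrightarrow> ideal_inv J \<subseteq> ideal_inv I"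
  by (auto simp: ideal_inv_def)

lemma v_closure_mono: "I \<subseteq> J \<Longrightarrow> v_closure I \<subseteq> v_closure J"
  unfolding v_closure_def by (intro ideal_inv_antimono)

lemma subset_v_closure: "I \<subseteq> v_closure I"
  by (auto simp: v_closure_def ideal_inv_def mult.commute)

text \<open>\<open>I \<subseteq> ideal_inv J\<close> and \<open>J \<subseteq> ideal_inv I\<close>
  both say that all products lie in the domain, so the inverse is an antitone Galois connection and
  three inverses collapse to one.\<close>

lemma ideal_inv_v_closure [simp]: "ideal_inv (v_closure I) = ideal_inv I"
proof
  show "ideal_inv (v_closure I) \<subseteq> ideal_inv I"
    by (intro ideal_inv_antimono subset_v_closure)
  show "ideal_inv I \<subseteq> ideal_inv (v_closure I)"
    using subset_v_closure[of "ideal_inv I"] by (simp add: v_closure_def)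
qed

lemma v_closure_idem [simp]: "v_closure (v_closure I) = v_closure I"
  by (metis ideal_inv_v_closure v_closure_def)

lemma v_closure_subset_iff: "v_closure I \<subseteq> v_closure J \<longleftrightarrow> I \<subseteq> v_closure J"
  by (metis order.trans subset_v_closure v_closure_idem v_closure_mono)

text \<open>For fixed \<open>x\<close> the \<open>y\<close> with \<open>x * y\<close> in the domain
  form a submodule, which contains a span once it contains the generators. Inverses and
  \<open>v\<close>-closures can thus be computed on generating sets.\<close>

lemma ideal_inv_span [simp]: "ideal_inv (fract.span S) = ideal_inv S"
proof
  show "ideal_inv (fract.span S) \<subseteq> ideal_inv S"
    by (intro ideal_inv_antimono fract.span_superset)
  show "ideal_inv S \<subseteq> ideal_inv (fract.span S)"
  proof
    fix x assume x: "x \<in> ideal_inv S"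
    have "fract.span S \<subseteq> {y. x * y \<in> base_ring}"
    proof (rule fract.span_minimal)
      show "S \<subseteq> {y. x * y \<in> base_ring}"
        using x by (auto simp: ideal_inv_def)
      show "fract.subspace {y. x * y \<in> base_ring}"
        by (rule fract.subspaceI)
          (simp_all add: distrib_left mult.left_commute[of x] fract.subspace_add[OF subspace_base_ring]
            fract.subspace_scale[OF subspace_base_ring])
    qed
    then show "x \<in> ideal_inv (fract.span S)"
      by (auto simp: ideal_inv_def)
  qed
qed

lemma v_closure_span [simp]: "v_closure (fract.span S) = v_closure S"
  by (simp add: v_closure_def)

lemma ideal_inv_base_ring [simp]: "ideal_inv base_ring = (base_ring :: 'a::idom fract set)"
proof
  show "ideal_inv base_ring \<subseteq> (base_ring :: 'a fract set)"
    unfolding ideal_inv_def using one_in_base_ring by (metis (mono_tags, lifting) mem_Collect_eq mult.right_neutral subsetI)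
  show "base_ring \<subseteq> ideal_inv (base_ring :: 'a fract set)"
    by (auto simp: ideal_inv_def simp flip: to_fract_mult)
qed

lemma v_closure_base_ring [simp]: "v_closure base_ring = (base_ring :: 'a::idom fract set)"
  by (simp add: v_closure_def)

lemma v_closure_subset_base_ring: "I \<subseteq> base_ring \<Longrightarrow> v_closure I \<subseteq> base_ring"
  by (metis v_closure_base_ring v_closure_mono)

lemma one_in_v_closure_iff: "1 \<in> v_closure I \<longleftrightarrow> ideal_inv I \<subseteq> base_ring"
  by (auto simp: v_closure_def ideal_inv_def[of "ideal_inv I"])

lemma base_ring_subset_iff: "fract.subspace I \<Longrightarrow> base_ring \<subseteq> I \<longleftrightarrow> 1 \<in> I"
proof
  assume I: "fract.subspace I"
  show "1 \<in> I" if "base_ring \<subseteq> I" using that by auto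
  show "base_ring \<subseteq> I" if "1 \<in> I"
    using fract.subspace_scale[OF I that] by auto
qed

text \<open>The inverse of \<open>{a}\<close> contains \<open>1 / a\<close>, so every
  \<open>x\<close> in the \<open>v\<close>-closure has \<open>x / a\<close> in the domain.\<close>

lemma v_closure_singleton: "a \<noteq> 0 \<Longrightarrow> v_closure {a} = fract.span {a}"
proof
  assume a: "a \<noteq> 0"
  show "v_closure {a} \<subseteq> fract.span {a}"
  proof
    fix x assume x: "x \<in> v_closure {a}"
    have "1 / a \<in> ideal_inv {a}" using a by (simp add: ideal_inv_def)
    then have "x * (1 / a) \<in> base_ring" using x by (simp only: v_closure_def ideal_inv_def[of "ideal_inv {a}"]) blast
    then obtain d where "x / a = to_fract d" by auto
    then have "x = to_fract d * a" using a by (simp add: field_simps)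
    then show "x \<in> fract.span {a}" by (simp add: fract.span_scale fract.span_base)
  qed
  show "fract.span {a} \<subseteq> v_closure {a}"
    by (rule fract.span_minimal[OF subset_v_closure subspace_v_closure])
qed

section \<open>Finite generating sets and the \<open>t\<close>-closure\<close>

lemma span_subset_zero_iff: "fract.span S = {0} \<longleftrightarrow> S \<subseteq> {0}"
  using fract.span_minimal[OF _ fract.subspace_single_0, of S] fract.span_superset[of S] fract.span_zero[of S]
  by blast

text \<open>Finite sets replace finitely generated modules from here on, a set and its span having
  the same \<open>v\<close>-closure; \<open>\<not> S \<subseteq> {0}\<close> expresses that the
  generated module is nonzero.\<close>

lemma in_t_closureE:
  assumes "x \<in> t_closure I"
  obtains S where "finite S" "\<not> S \<subseteq> {0}" "S \<subseteq> I" "x \<in> v_closure S"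
proof -
  from assms obtain S where "finite S" "fract.span S \<noteq> {0}" "fract.span S \<subseteq> I" "x \<in> v_closure (fract.span S)"
    unfolding t_closure_def fg_nonzero_def by blast
  then show thesis
    using that[of S] fract.span_superset[of S] by (simp add: span_subset_zero_iff)
qed

lemma in_t_closureI:
  assumes "fract.subspace I" "finite S" "\<not> S \<subseteq> {0}" "S \<subseteq> I" "x \<in> v_closure S"
  shows "x \<in> t_closure I"
proof -
  have "fg_nonzero (fract.span S)"
    using assms by (auto simp: fg_nonzero_def span_subset_zero_iff)
  moreover have "fract.span S \<subseteq> I"
    using assms by (intro fract.span_minimal)
  ultimately show ?thesis
    using assms(5) unfolding t_closure_def by (metis (mono_tags, lifting) UnionI mem_Collect_eq v_closure_span)
qed

lemma t_closure_mono: "I \<subseteq> J \<Longrightarrow> t_closure I \<subseteq> t_closure J"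
  unfolding t_closure_def by blast

lemma t_closure_subset_v_closure: "t_closure I \<subseteq> v_closure I"
  unfolding t_closure_def using v_closure_mono by blast

lemma t_closure_fg: "fg_nonzero J \<Longrightarrow> t_closure J = v_closure J"
  using t_closure_subset_v_closure[of J] unfolding t_closure_def by blast

lemma subset_t_closure:
  assumes I: "fract.subspace I" "I \<noteq> {0}"
  shows "I \<subseteq> t_closure I"
proof
  fix x assume x: "x \<in> I"
  \<comment> \<open>Since \<open>x\<close> may be \<open>0\<close>, a nonzero \<open>y\<close> is
    put beside it to obtain an admissible finite set.\<close>
  obtain y where "y \<in> I" "y \<noteq> 0"
    using I fract.subspace_0 by blast
  then show "x \<in> t_closure I"
    using x subset_v_closure[of "{x,y}"] by (intro in_t_closureI[OF I(1), of "{x,y}"]) auto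
qed

text \<open>The union over finite subsets is directed: elements of the \<open>v\<close>-closures of
  \<open>S\<close> and \<open>T\<close> both lie in that of \<open>S \<union> T\<close>.\<close>

lemma subspace_t_closure:
  assumes I: "fract.subspace I" "I \<noteq> {0}"
  shows "fract.subspace (t_closure I)"
proof (rule fract.subspaceI)
  show "0 \<in> t_closure I"
    using subset_t_closure[OF I] fract.subspace_0[OF I(1)] by blast
next
  fix x y assume "x \<in> t_closure I" "y \<in> t_closure I"
  obtain S where S: "finite S" "\<not> S \<subseteq> {0}" "S \<subseteq> I" "x \<in> v_closure S"
    using \<open>x \<in> t_closure I\<close> by (rule in_t_closureE)
  obtain T where T: "finite T" "\<not> T \<subseteq> {0}" "T \<subseteq> I" "y \<in> v_closure T"
    using \<open>y \<in> t_closure I\<close> by (rule in_t_closureE)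
  have "x \<in> v_closure (S \<union> T)" "y \<in> v_closure (S \<union> T)"
    using S T v_closure_mono[of S "S \<union> T"] v_closure_mono[of T "S \<union> T"] by auto
  then show "x + y \<in> t_closure I"
    using S T by (intro in_t_closureI[OF I(1), of "S \<union> T"] fract.subspace_add[OF subspace_v_closure]) auto
next
  fix c x assume "x \<in> t_closure I"
  then show "to_fract c * x \<in> t_closure I"
    by (metis in_t_closureE in_t_closureI[OF I(1)] fract.subspace_scale[OF subspace_v_closure])
qed

text \<open>Directedness, iterated over \<open>S\<close>. This is what makes the
  \<open>t\<close>-closure idempotent.\<close>

lemma finite_subset_t_closure:
  assumes I: "fract.subspace I" "I \<noteq> {0}" and "finite S" "S \<subseteq> t_closure I"
  obtains T where "finite T" "\<not> T \<subseteq> {0}" "T \<subseteq> I" "S \<subseteq> v_closure T"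
proof -
  have "\<exists>T. finite T \<and> \<not> T \<subseteq> {0} \<and> T \<subseteq> I \<and> S \<subseteq> v_closure T"
    using \<open>finite S\<close> \<open>S \<subseteq> t_closure I\<close>
  proof (induction S)
    case empty
    obtain y where "y \<in> I" "y \<noteq> 0"
      using I fract.subspace_0 by blast
    then show ?case by (intro exI[of _ "{y}"]) auto
  next
    case (insert x S)
    then obtain T where T: "finite T" "\<not> T \<subseteq> {0}" "T \<subseteq> I" "S \<subseteq> v_closure T" by auto
    obtain T' where T': "finite T'" "\<not> T' \<subseteq> {0}" "T' \<subseteq> I" "x \<in> v_closure T'"
      using insert.prems in_t_closureE[of x I] by auto
    have "insert x S \<subseteq> v_closure (T \<union> T')"
      using T T' v_closure_mono[of T "T \<union> T'"] v_closure_mono[of T' "T \<union> T'"] by auto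
    then show ?case using T T' by (intro exI[of _ "T \<union> T'"]) auto
  qed
  then show thesis using that by blast
qed

lemma t_closure_idem:
  assumes I: "fract.subspace I" "I \<noteq> {0}"
  shows "t_closure (t_closure I) = t_closure I"
proof
  have "t_closure I \<noteq> {0}" using I subset_t_closure[OF I] fract.subspace_0[OF I(1)] by blast
  then show "t_closure I \<subseteq> t_closure (t_closure I)"
    by (intro subset_t_closure subspace_t_closure I)
  show "t_closure (t_closure I) \<subseteq> t_closure I"
  proof
    fix x assume "x \<in> t_closure (t_closure I)"
    then obtain S where S: "finite S" "S \<subseteq> t_closure I" "x \<in> v_closure S"
      by (elim in_t_closureE)
    obtain T where T: "finite T" "\<not> T \<subseteq> {0}" "T \<subseteq> I" "S \<subseteq> v_closure T"
      using finite_subset_t_closure[OF I S(1,2)] .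
    then have "x \<in> v_closure T"
      using S v_closure_subset_iff[of S T] by blast
    then show "x \<in> t_closure I"
      using T by (intro in_t_closureI[OF I(1)])
  qed
qed

lemma v_closure_subset_t_ideal:
  assumes "t_ideal I" "finite S" "\<not> S \<subseteq> {0}" "S \<subseteq> I"
  shows "v_closure S \<subseteq> I"
  using assms in_t_closureI[of I S] by (auto simp: t_ideal_def fractional_ideal_def)

lemma t_idealI:
  assumes "fractional_ideal I" "I \<noteq> {0}" "t_closure I \<subseteq> I"
  shows "t_ideal I"
  using assms subset_t_closure[of I] by (auto simp: t_ideal_def fractional_ideal_def)

lemma t_closure_subset_base_ring: "I \<subseteq> base_ring \<Longrightarrow> t_closure I \<subseteq> base_ring"
  using t_closure_subset_v_closure v_closure_subset_base_ring by blast

section \<open>Proper ideals, \<open>t\<close>-invertibility and maximal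
  \<open>t\<close>-ideals\<close>

lemma proper_idealsI:
  assumes "fract.subspace I" "I \<noteq> {0}" "I \<subseteq> base_ring" "1 \<notin> I"
  shows "I \<in> proper_ideals"
  using assms by (auto simp: proper_ideals_def proper_nonzero_def fractional_ideal_def
      intro!: exI[of _ 1])

lemma proper_idealsD:
  assumes "I \<in> proper_ideals"
  shows "fract.subspace I" "I \<noteq> {0}" "I \<subseteq> base_ring" "1 \<notin> I"
  using assms base_ring_subset_iff[of I]
  by (auto simp: proper_ideals_def proper_nonzero_def fractional_ideal_def)

lemma proper_t_idealsD:
  assumes "I \<in> proper_t_ideals"
  shows "I \<in> proper_ideals" "t_ideal I"
  using assms by (auto simp: proper_t_ideals_def)

lemma t_closure_in_proper_t_ideals:
  assumes I: "fract.subspace I" "I \<noteq> {0}" "I \<subseteq> base_ring" "1 \<notin> t_closure I"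
  shows "t_closure I \<in> proper_t_ideals"
proof -
  have nz: "t_closure I \<noteq> {0}" using I subset_t_closure[OF I(1,2)] fract.subspace_0[OF I(1)] by blast
  have "t_closure I \<in> proper_ideals"
    by (intro proper_idealsI subspace_t_closure t_closure_subset_base_ring nz I)
  then show ?thesis
    using t_idealI[of "t_closure I"] t_closure_idem[OF I(1,2)] nz
    by (auto simp: proper_t_ideals_def proper_ideals_def)
qed

lemma ideal_prod_inv_subset: "ideal_prod I (ideal_inv I) \<subseteq> base_ring"
  unfolding ideal_prod_def
  by (rule fract.span_minimal[OF _ subspace_base_ring]) (auto simp: ideal_inv_def mult.commute)

text \<open>The product of \<open>I\<close> with its inverse lies in the domain, so its
  \<open>t\<close>-closure, when the product is nonzero, is a submodule of the domain and is
  everything once it contains \<open>1\<close>.\<close>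

lemma t_invertible_iff:
  assumes "fractional_ideal I" "I \<noteq> {0}"
  shows "t_invertible I \<longleftrightarrow> 1 \<in> t_closure (ideal_prod I (ideal_inv I))"
proof -
  let ?P = "ideal_prod I (ideal_inv I)"
  have "t_closure ?P = base_ring" if 1: "1 \<in> t_closure ?P"
  proof
    show "t_closure ?P \<subseteq> base_ring"
      by (intro t_closure_subset_base_ring ideal_prod_inv_subset)
    have "?P \<noteq> {0}"
      using 1 by (auto elim: in_t_closureE)
    then show "base_ring \<subseteq> t_closure ?P"
      using subspace_t_closure[of ?P] 1 by (simp add: base_ring_subset_iff ideal_prod_def)
  qed
  then show ?thesis using assms by (auto simp: t_invertible_def)
qed

text \<open>Zorn's lemma: the union of a chain of proper \<open>t\<close>-ideals omits
  \<open>1\<close>, and it is a \<open>t\<close>-ideal because the \<open>t\<close>-closure only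
  looks at finite subsets, each of which lies in a single member of the chain.\<close>

lemma ex_maximal_proper_t_ideal:
  assumes I: "I \<in> proper_t_ideals"
  obtains M where "M \<in> proper_t_ideals" "I \<subseteq> M"
    "\<And>N. N \<in> proper_t_ideals \<Longrightarrow> M \<subseteq> N \<Longrightarrow> N = M"
proof -
  define A where "A = {M \<in> proper_t_ideals. I \<subseteq> M}"
  have "\<exists>M\<in>A. \<forall>X\<in>A. M \<subseteq> X \<longrightarrow> X = M"
  proof (rule subset_Zorn_nonempty)
    show "A \<noteq> {}" using I by (auto simp: A_def)
    fix C assume C: "C \<noteq> {}" "subset.chain A C"
    then have CA: "C \<subseteq> proper_t_ideals" and IC: "\<And>X. X \<in> C \<Longrightarrow> I \<subseteq> X"
      and lin: "\<And>X Y. X \<in> C \<Longrightarrow> Y \<in> C \<Longrightarrow> X \<subseteq> Y \<or> Y \<subseteq> X"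
      unfolding subset_chain_def A_def by blast+
    from C(1) IC have IU: "I \<subseteq> \<Union>C" by blast
    have Csub: "fract.subspace X" and Cbase: "X \<subseteq> base_ring" and C1: "1 \<notin> X" and Ct: "t_ideal X"
      if "X \<in> C" for X
      using CA that proper_t_idealsD[of X] proper_idealsD[of X] by blast+
    have Isub: "fract.subspace I" and I0: "I \<noteq> {0}"
      using proper_idealsD(1,2) proper_t_idealsD(1)[OF I] by blast+
    have sub: "fract.subspace (\<Union>C)"
    proof (rule fract.subspaceI)
      show "0 \<in> \<Union>C"
        using IU fract.subspace_0[OF Isub] by blast
      show "x + y \<in> \<Union>C" if xy: "x \<in> \<Union>C" "y \<in> \<Union>C" for x y
      proof -
        obtain X Y where XY: "X \<in> C" "x \<in> X" "Y \<in> C" "y \<in> Y" using xy by auto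
        then obtain Z where Z: "Z \<in> C" "x \<in> Z" "y \<in> Z" using lin[of X Y] by blast
        then have "x + y \<in> Z"
          by (intro fract.subspace_add[OF Csub])
        then show ?thesis using Z by blast
      qed
      show "to_fract c * x \<in> \<Union>C" if x: "x \<in> \<Union>C" for c x
      proof -
        obtain X where X: "X \<in> C" "x \<in> X" using x by auto
        then have "to_fract c * x \<in> X"
          by (intro fract.subspace_scale[OF Csub])
        then show ?thesis using X by blast
      qed
    qed
    have nz: "\<Union>C \<noteq> {0}"
      using IU I0 fract.subspace_0[OF Isub] by blast
    have pr: "\<Union>C \<in> proper_ideals"
      using Cbase C1 by (intro proper_idealsI[OF sub nz]) blast+
    have "t_closure (\<Union>C) \<subseteq> \<Union>C"
    proof
      fix x assume "x \<in> t_closure (\<Union>C)"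
      then obtain S where S: "finite S" "\<not> S \<subseteq> {0}" "S \<subseteq> \<Union>C" "x \<in> v_closure S"
        by (rule in_t_closureE)
      obtain X where X: "X \<in> C" "S \<subseteq> X"
        using finite_subset_Union_chain[OF S(1,3) C] .
      then have "x \<in> X"
        using v_closure_subset_t_ideal[OF Ct S(1,2)] S by blast
      then show "x \<in> \<Union>C" using X by auto
    qed
    then have "t_ideal (\<Union>C)"
      using pr nz by (intro t_idealI) (simp_all add: proper_ideals_def)
    then show "\<Union>C \<in> A"
      using pr IU by (auto simp: proper_t_ideals_def A_def)
  qed
  then obtain M where M: "M \<in> A" "\<And>X. X \<in> A \<Longrightarrow> M \<subseteq> X \<Longrightarrow> X = M" by blast
  show thesis
  proof (rule that)
    show "M \<in> proper_t_ideals" "I \<subseteq> M" using M(1) by (simp_all add: A_def)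
    show "N = M" if "N \<in> proper_t_ideals" "M \<subseteq> N" for N
      using that M by (auto simp: A_def)
  qed
qed

text \<open>Each element of a span involves only finitely many generators; these are collected over
  the finite set \<open>T\<close>.\<close>

lemma span_finite_subset:
  assumes "finite T" "T \<subseteq> fract.span U"
  obtains V where "finite V" "V \<subseteq> U" "T \<subseteq> fract.span V"
proof -
  have one: "\<exists>V. finite V \<and> V \<subseteq> U \<and> x \<in> fract.span V" if "x \<in> fract.span U" for x
    using that
  proof (induction rule: fract.span_induct_alt)
    case base
    show ?case by (intro exI[of _ "{}"]) (simp add: fract.span_zero)
  next
    case (step c x y)
    then obtain V where V: "finite V" "V \<subseteq> U" "y \<in> fract.span V" by auto
    have "to_fract c * x + y \<in> fract.span (insert x V)"
      using V(3) fract.span_mono[of V "insert x V"]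
      by (intro fract.span_add[OF fract.span_scale[OF fract.span_base]]) auto
    then show ?case using V step by (intro exI[of _ "insert x V"]) auto
  qed
  have "\<forall>x\<in>T. \<exists>V. finite V \<and> V \<subseteq> U \<and> x \<in> fract.span V"
    using one assms(2) by blast
  from bchoice[OF this] obtain V where V: "\<And>x. x \<in> T \<Longrightarrow> finite (V x) \<and> V x \<subseteq> U \<and> x \<in> fract.span (V x)"
    by blast
  have "T \<subseteq> fract.span (\<Union>x\<in>T. V x)"
    using V fract.span_mono[of "V _" "\<Union>x\<in>T. V x"] by blast
  moreover have "finite (\<Union>x\<in>T. V x)" "(\<Union>x\<in>T. V x) \<subseteq> U"
    using V assms(1) by blast+
  ultimately show thesis by (rule that[rotated 2])
qed

subsection \<open>Polynomials over the quotient field inside the quotient field of \<open>R\<close>\<close>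

text \<open>The embedding of \<open>F\<close> into the quotient field of \<open>D[X]\<close> induced
  by the constants. It is described through fractions; independence of the chosen fraction is
  established in \<open>const_fract_Fract\<close>.\<close>

definition const_fract :: "'a::idom fract \<Rightarrow> 'a poly fract" where
  "const_fract x = (THE y. \<forall>a b. b \<noteq> 0 \<longrightarrow> x = Fract a b \<longrightarrow> y = Fract [:a:] [:b:])"

lemma const_fract_Fract:
  assumes "b \<noteq> 0"
  shows "const_fract (Fract a b) = Fract [:a:] [:b:]"
  unfolding const_fract_def
proof (rule the_equality)
  show "\<forall>a' b'. b' \<noteq> 0 \<longrightarrow> Fract a b = Fract a' b' \<longrightarrow> Fract [:a:] [:b:] = Fract [:a':] [:b':]"
    using assms by (auto simp: eq_fract mult.commute)
qed (use assms in blast)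

lemma const_fract_to_fract: "const_fract (to_fract a) = to_fract [:a:]"
  by (simp add: to_fract_def const_fract_Fract one_pCons)

lemma const_fract_0 [simp]: "const_fract 0 = 0"
  using const_fract_to_fract[of 0] by simp

lemma const_fract_1 [simp]: "const_fract 1 = 1"
  using const_fract_to_fract[of 1] by (simp flip: one_pCons)

lemma const_fract_add: "const_fract (x + y) = const_fract x + const_fract y"
  by (cases x; cases y) (simp add: const_fract_Fract mult.commute)

lemma const_fract_mult: "const_fract (x * y) = const_fract x * const_fract y"
  by (cases x; cases y) (simp add: const_fract_Fract mult.commute)

lemma const_fract_eq_0_iff [simp]: "const_fract x = 0 \<longleftrightarrow> x = 0"
  by (cases x) (simp add: const_fract_Fract Zero_fract_def eq_fract)

text \<open>Evaluation at the indeterminate, which embeds \<open>F[X]\<close> into the quotient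
  field of \<open>D[X]\<close>. Ideals of \<open>D[X]\<close> can then be handled through
  polynomials over \<open>F\<close>.\<close>

definition poly_fract :: "'a::idom fract poly \<Rightarrow> 'a poly fract" where
  "poly_fract p = poly (map_poly const_fract p) (to_fract [:0, 1:])"

lemma poly_fract_0 [simp]: "poly_fract 0 = 0"
  by (simp add: poly_fract_def)

lemma poly_fract_pCons:
  "poly_fract (pCons a p) = const_fract a + to_fract [:0, 1:] * poly_fract p"
  by (simp add: poly_fract_def map_poly_pCons)

lemma poly_fract_const [simp]: "poly_fract [:a:] = const_fract a"
  by (simp add: poly_fract_pCons)

lemma poly_fract_1 [simp]: "poly_fract 1 = 1"
  by (simp add: one_pCons)

lemma poly_fract_add: "poly_fract (p + q) = poly_fract p + poly_fract q"
  by (induction p q rule: poly_induct2) (simp_all add: poly_fract_pCons const_fract_add algebra_simps)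

lemma poly_fract_smult: "poly_fract (smult c p) = const_fract c * poly_fract p"
  by (induction p) (simp_all add: poly_fract_pCons const_fract_mult algebra_simps)

lemma poly_fract_mult: "poly_fract (p * q) = poly_fract p * poly_fract q"
  by (induction p) (simp_all add: poly_fract_pCons poly_fract_add poly_fract_smult algebra_simps)

lemma poly_fract_fract_poly: "poly_fract (fract_poly g) = to_fract g"
proof (induction g)
  case (pCons a g)
  have "pCons a g = [:a:] + [:0, 1:] * g" by simp
  then have "to_fract (pCons a g) = to_fract [:a:] + to_fract [:0, 1:] * to_fract g"
    by (simp only: to_fract_add to_fract_mult)
  then show ?case
    using pCons by (simp add: map_poly_pCons poly_fract_pCons const_fract_to_fract)
qed simp

lemma fract_common_denominator:
  assumes "finite (A :: 'a::idom fract set)"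
  obtains d where "d \<noteq> 0" "\<And>x. x \<in> A \<Longrightarrow> to_fract d * x \<in> base_ring"
proof -
  have "\<exists>d. d \<noteq> 0 \<and> (\<forall>x\<in>A. to_fract d * x \<in> base_ring)"
    using assms
  proof (induction A)
    case empty
    show ?case by (intro exI[of _ 1]) auto
  next
    case (insert x A)
    then obtain d where d: "d \<noteq> 0" "\<forall>x\<in>A. to_fract d * x \<in> base_ring" by auto
    obtain a b where "x = Fract a b" and b: "b \<noteq> 0" by (cases x)
    then have "to_fract b * x = to_fract a"
      by (simp add: Fract_conv_to_fract)
    moreover have "to_fract (b * d) * x = to_fract d * (to_fract b * x)"
      unfolding to_fract_mult by (simp only: mult_ac)
    ultimately have "to_fract (b * d) * x = to_fract (d * a)"
      by (simp only: to_fract_mult)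
    moreover have "to_fract (b * d) * y \<in> base_ring" if "y \<in> A" for y
      using d that fract.subspace_scale[OF subspace_base_ring, of "to_fract d * y" b]
      unfolding to_fract_mult mult.assoc by blast
    ultimately show ?case
      using d b by (intro exI[of _ "b * d"]) (simp del: to_fract_mult)
  qed
  then show thesis using that by blast
qed

section \<open>Polynomials over \<open>F\<close> with coefficients in \<open>D\<close>\<close>

definition integral_poly :: "'a::idom fract poly \<Rightarrow> bool" where
  "integral_poly p \<longleftrightarrow> (\<forall>i. coeff p i \<in> base_ring)"

lemma integral_poly_fract_poly [simp]: "integral_poly (fract_poly g)"
  by (simp add: integral_poly_def coeff_map_poly)

lemma integral_polyE:
  assumes "integral_poly p"
  obtains g where "p = fract_poly g"
proof (rule that)
  \<comment> \<open>\<open>coeff_map_poly\<close> requires a coefficient map that sends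
    \<open>0\<close> to \<open>0\<close>; for \<open>inv to_fract\<close> this rests on the
    injectivity of \<open>to_fract\<close>.\<close>
  have "inv to_fract (0 :: 'a fract) = (0 :: 'a)"
    by (metis inv_f_f injI to_fract_0 to_fract_eq_iff)
  then show "p = fract_poly (map_poly (inv to_fract) p)"
    using assms by (intro poly_eqI) (simp add: coeff_map_poly integral_poly_def f_inv_into_f)
qed

lemma integral_poly_add: "integral_poly p \<Longrightarrow> integral_poly q \<Longrightarrow> integral_poly (p + q)"
  by (simp add: integral_poly_def fract.subspace_add[OF subspace_base_ring])

lemma integral_poly_diff: "integral_poly p \<Longrightarrow> integral_poly q \<Longrightarrow> integral_poly (p - q)"
  by (simp add: integral_poly_def fract.subspace_diff[OF subspace_base_ring])

lemma integral_poly_mult: "integral_poly p \<Longrightarrow> integral_poly q \<Longrightarrow> integral_poly (p * q)"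
  by (simp add: integral_poly_def coeff_mult fract.subspace_sum[OF subspace_base_ring]
      to_fract_mult_in_base_ring)

lemma integral_poly_smult: "c \<in> base_ring \<Longrightarrow> integral_poly p \<Longrightarrow> integral_poly (smult c p)"
  by (simp add: integral_poly_def to_fract_mult_in_base_ring)

lemma integral_poly_monom: "c \<in> base_ring \<Longrightarrow> integral_poly (monom c n)"
  by (simp add: integral_poly_def)

lemma clear_denominators:
  obtains d where "d \<noteq> 0" "integral_poly (smult (to_fract d) p)"
proof -
  have "finite (coeff p ` {..degree p})" by simp
  then obtain d where d: "d \<noteq> 0" "\<And>x. x \<in> coeff p ` {..degree p} \<Longrightarrow> to_fract d * x \<in> base_ring"
    using fract_common_denominator by blast
  have "to_fract d * coeff p i \<in> base_ring" for i
    using d(2) by (cases "i \<le> degree p") (auto simp: coeff_eq_0)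
  then show thesis using that d(1) by (simp add: integral_poly_def)
qed

text \<open>After clearing denominators, \<open>p\<close> comes from a polynomial over
  \<open>D\<close>, where \<open>to_fract\<close> is injective.\<close>

lemma poly_fract_eq_0_iff [simp]: "poly_fract p = 0 \<longleftrightarrow> p = 0"
proof
  assume 0: "poly_fract p = 0"
  obtain d where d: "d \<noteq> 0" "integral_poly (smult (to_fract d) p)"
    by (rule clear_denominators)
  from d(2) obtain g where g: "smult (to_fract d) p = fract_poly g"
    by (rule integral_polyE)
  have "to_fract g = 0"
    using 0 by (simp add: poly_fract_smult flip: poly_fract_fract_poly g)
  then show "p = 0" using g d by simp
qed simp

lemma poly_fract_eq_iff [simp]: "poly_fract p = poly_fract q \<longleftrightarrow> p = q"
  using poly_fract_eq_0_iff[of "p - q"] poly_fract_add[of "p - q" q] by auto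

lemma poly_fract_in_base_ring_iff: "poly_fract p \<in> base_ring \<longleftrightarrow> integral_poly p"
proof
  assume "poly_fract p \<in> base_ring"
  then obtain g where "poly_fract p = poly_fract (fract_poly g)"
    by (auto simp: poly_fract_fract_poly)
  then show "integral_poly p" by simp
next
  assume "integral_poly p"
  then show "poly_fract p \<in> base_ring"
    by (auto elim!: integral_polyE simp: poly_fract_fract_poly)
qed

lemma base_ring_subset_range_poly_fract: "base_ring \<subseteq> range poly_fract"
  using poly_fract_fract_poly by (metis image_subsetI rangeI)

text \<open>A nonzero constant is a unit of \<open>F[X]\<close>. This is how an element of an
  inverse is recognised as a polynomial over \<open>F\<close>: its product with some nonzero
  constant is integral.\<close>

lemma range_poly_fract_divide_const:
  assumes "z * const_fract c \<in> range poly_fract" "c \<noteq> 0"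
  shows "z \<in> range poly_fract"
proof -
  obtain p where "z * const_fract c = poly_fract p" using assms(1) by auto
  then have "poly_fract (smult (1 / c) p) = z * const_fract (c * (1 / c))"
    unfolding poly_fract_smult const_fract_mult by (simp add: mult_ac)
  then show ?thesis using assms(2) by (metis const_fract_1 mult.right_neutral nonzero_mult_div_cancel_left rangeI times_divide_eq_right)
qed

text \<open>McCoy's argument: with \<open>i\<close> the largest index at which \<open>coeff f i\<close> does not clear the
  denominators of \<open>h\<close>, the product \<open>coeff f i * lead_coeff h\<close> is integral, so the leading term can
  be removed from \<open>smult (coeff f i) h\<close>.\<close>

lemma McCoy_integral:
  assumes "\<And>f. f \<in> B \<Longrightarrow> integral_poly f" "\<And>f. f \<in> B \<Longrightarrow> integral_poly (h * f)" "\<not> integral_poly h"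
  shows "\<exists>e. e \<notin> base_ring \<and> (\<forall>f\<in>B. \<forall>i. e * coeff f i \<in> base_ring)"
  using assms(2,3)
proof (induction "degree h" arbitrary: h rule: less_induct)
  case (less h)
  show ?case
  proof (cases "\<forall>f\<in>B. \<forall>i. integral_poly (smult (coeff f i) h)")
    case True
    \<comment> \<open>Here every product of a coefficient of \<open>h\<close> with a coefficient of
      a member of \<open>B\<close> is integral, so any nonintegral coefficient of \<open>h\<close>
      serves as \<open>e\<close>.\<close>
    obtain j where "coeff h j \<notin> base_ring"
      using less.prems(2) by (auto simp: integral_poly_def)
    then show ?thesis
      using True by (intro exI[of _ "coeff h j"]) (simp add: integral_poly_def mult.commute)
  next
    case False
    then obtain f where f: "f \<in> B" "\<exists>i. \<not> integral_poly (smult (coeff f i) h)" by auto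
    define I where "I = {i. \<not> integral_poly (smult (coeff f i) h)}"
    define i where "i = Max I"
    have "I \<subseteq> {..degree f}"
      using integral_poly_fract_poly[of 0] by (auto simp: I_def intro: le_degree)
    then have "finite I" by (rule finite_subset) simp
    then have i: "\<not> integral_poly (smult (coeff f i) h)"
      and gt: "\<And>j. j > i \<Longrightarrow> integral_poly (smult (coeff f j) h)"
      using f(2) Max_in[of I] Max_ge[of I] unfolding i_def I_def by (auto simp: not_le)
    define n where "n = degree h"
    define a where "a = coeff f i"
    define c where "c = a * coeff h n"
    \<comment> \<open>For \<open>k < n\<close> the index \<open>n + i - k\<close> exceeds
      \<open>i\<close>, so the term is integral by the choice of \<open>i\<close>; for
      \<open>k > n\<close> it vanishes.\<close>
    have "coeff h k * coeff f (n + i - k) \<in> base_ring" if "k \<in> {..n + i} - {n}" for k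
    proof (cases "k < n")
      case True
      then show ?thesis using gt[of "n + i - k"] by (simp add: integral_poly_def mult.commute)
    next
      case False
      then show ?thesis using that by (simp add: n_def coeff_eq_0)
    qed
    then have "(\<Sum>k\<in>{..n + i} - {n}. coeff h k * coeff f (n + i - k)) \<in> base_ring"
      by (rule fract.subspace_sum[OF subspace_base_ring])
    moreover have "coeff (h * f) (n + i) = c + (\<Sum>k\<in>{..n + i} - {n}. coeff h k * coeff f (n + i - k))"
      unfolding coeff_mult c_def a_def by (subst sum.remove[of _ n]) (simp_all add: mult.commute)
    moreover have "coeff (h * f) (n + i) \<in> base_ring"
      using less.prems(1)[OF f(1)] by (simp add: integral_poly_def)
    ultimately have c: "c \<in> base_ring"
      using fract.subspace_diff[OF subspace_base_ring] by (metis add_diff_cancel_right')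
    define h' where "h' = smult a h - monom c n"
    have h': "\<not> integral_poly h'"
      using i integral_poly_add[of h' "monom c n"] integral_poly_monom[OF c]
      by (auto simp: h'_def a_def)
    have "coeff h' k = 0" if "k \<ge> n" for k
      using that by (cases "k = n") (simp_all add: h'_def c_def n_def coeff_eq_0)
    moreover have "coeff h' (degree h') \<noteq> 0"
      using h' integral_poly_fract_poly[of 0] by auto
    ultimately have "degree h' < degree h"
      unfolding n_def by (meson not_le)
    moreover have "integral_poly (h' * f')" if "f' \<in> B" for f'
    proof -
      have "h' * f' = smult a (h * f') - monom c n * f'"
        by (simp add: h'_def algebra_simps)
      moreover have "a \<in> base_ring"
        using assms(1)[OF f(1)] by (simp add: a_def integral_poly_def)
      ultimately show ?thesis
        using less.prems(1)[OF that] assms(1)[OF that] c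
        by (simp add: integral_poly_diff integral_poly_smult integral_poly_mult integral_poly_monom)
    qed
    ultimately show ?thesis
      using less.hyps h' by blast
  qed
qed

section \<open>The extension \<open>I[X]\<close> and the coefficients of a set of
  polynomials\<close>

definition poly_extension :: "'a::idom fract set \<Rightarrow> 'a poly fract set" where
  "poly_extension I = poly_fract ` {p. \<forall>i. coeff p i \<in> I}"

text \<open>Elements of \<open>B\<close> outside \<open>F[X]\<close> contribute nothing. As
  \<open>i\<close> ranges over all indices, \<open>0\<close> belongs to the result as soon as
  \<open>B\<close> meets \<open>F[X]\<close>.\<close>

definition coefficients :: "'a::idom poly fract set \<Rightarrow> 'a fract set" where
  "coefficients B = {coeff p i |p i. poly_fract p \<in> B}"

lemma poly_fract_in_poly_extension_iff [simp]:
  "poly_fract p \<in> poly_extension I \<longleftrightarrow> (\<forall>i. coeff p i \<in> I)"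
  by (auto simp: poly_extension_def)

lemma const_fract_in_poly_extension_iff:
  "0 \<in> I \<Longrightarrow> const_fract x \<in> poly_extension I \<longleftrightarrow> x \<in> I"
  using poly_fract_in_poly_extension_iff[of "[:x:]" I]
  by (auto simp: coeff_pCons split: nat.splits)

lemma poly_extension_base_ring [simp]: "poly_extension base_ring = base_ring"
proof -
  have "poly_extension base_ring = {z \<in> range poly_fract. z \<in> base_ring}"
    unfolding poly_extension_def using poly_fract_in_base_ring_iff integral_poly_def by blast
  then show ?thesis using base_ring_subset_range_poly_fract by blast
qed

lemma poly_extension_mono: "I \<subseteq> J \<Longrightarrow> poly_extension I \<subseteq> poly_extension J"
  by (auto simp: poly_extension_def)

lemma poly_extension_subset_iff:
  "0 \<in> I \<Longrightarrow> 0 \<in> J \<Longrightarrow> poly_extension I \<subseteq> poly_extension J \<longleftrightarrow> I \<subseteq> J"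
  by (meson const_fract_in_poly_extension_iff poly_extension_mono subset_iff)

lemma poly_extension_subset_range: "poly_extension I \<subseteq> range poly_fract"
  by (auto simp: poly_extension_def)

lemma subspace_poly_extension:
  assumes I: "fract.subspace I"
  shows "fract.subspace (poly_extension I)"
proof (rule fract.subspaceI)
  show "0 \<in> poly_extension I"
    using poly_fract_in_poly_extension_iff[of 0 I] fract.subspace_0[OF I] by simp
  show "x + y \<in> poly_extension I" if "x \<in> poly_extension I" "y \<in> poly_extension I" for x y
    using that by (auto simp: poly_extension_def poly_fract_add[symmetric] fract.subspace_add[OF I])
  show "to_fract g * x \<in> poly_extension I" if "x \<in> poly_extension I" for g x
    using that by (auto simp: poly_extension_def poly_fract_fract_poly[symmetric] poly_fract_mult[symmetric]
        coeff_mult coeff_map_poly fract.subspace_sum[OF I] fract.subspace_scale[OF I])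
qed

text \<open>The adjunction by which statements about contents and statements about extended ideals
  are exchanged.\<close>

lemma coefficients_subset_iff:
  "B \<subseteq> range poly_fract \<Longrightarrow> coefficients B \<subseteq> I \<longleftrightarrow> B \<subseteq> poly_extension I"
  unfolding coefficients_def poly_extension_def by (auto simp: image_iff subset_iff) blast

lemma coefficients_subset:
  "B \<subseteq> poly_extension I \<Longrightarrow> coefficients B \<subseteq> I"
  using coefficients_subset_iff[of B I] poly_extension_subset_range[of I] by simp

lemma coefficients_mono: "B \<subseteq> C \<Longrightarrow> coefficients B \<subseteq> coefficients C"
  by (auto simp: coefficients_def)

lemma subset_poly_extension_coefficients:
  "B \<subseteq> range poly_fract \<Longrightarrow> B \<subseteq> poly_extension (fract.span (coefficients B))"
  by (simp add: fract.span_superset flip: coefficients_subset_iff)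

lemma finite_coefficients:
  assumes "finite B"
  shows "finite (coefficients B)"
proof -
  \<comment> \<open>The inserted \<open>0\<close> accounts for the indices beyond the
    degree.\<close>
  have "coefficients B \<subseteq> insert 0 (\<Union>p\<in>poly_fract -` B. coeff p ` {..degree p})"
    by (auto simp: coefficients_def) (metis atMost_iff imageI le_degree vimageI)
  moreover have "finite (poly_fract -` B)"
    using assms by (intro finite_vimageI injI) simp_all
  ultimately show ?thesis
    by (meson finite_UN_I finite_atMost finite_imageI finite_insert finite_subset)
qed

text \<open>For every element of \<open>U\<close> one polynomial of \<open>Q\<close> in which it
  occurs is chosen.\<close>

lemma finite_subset_coefficients:
  assumes "finite U" "U \<subseteq> coefficients Q"
  obtains B where "finite B" "B \<subseteq> Q" "U \<subseteq> coefficients B"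
proof -
  have "\<forall>u\<in>U. \<exists>p. poly_fract p \<in> Q \<and> u \<in> range (coeff p)"
    using assms(2) unfolding coefficients_def by blast
  from bchoice[OF this] obtain p where p: "\<forall>u\<in>U. poly_fract (p u) \<in> Q \<and> u \<in> range (coeff (p u))"
    by blast
  show thesis
  proof (rule that[of "(\<lambda>u. poly_fract (p u)) ` U"])
    show "U \<subseteq> coefficients ((\<lambda>u. poly_fract (p u)) ` U)"
    proof
      fix u assume "u \<in> U"
      then show "u \<in> coefficients ((\<lambda>u. poly_fract (p u)) ` U)"
        using p unfolding coefficients_def by blast
    qed
  qed (use p assms in auto)
qed

text \<open>The constant \<open>c\<close> forces an element of the inverse to be a polynomial
  \<open>h\<close> over \<open>F\<close>. If \<open>h\<close> were not integral, McCoy's argument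
  would give an \<open>e\<close> outside \<open>D\<close> that multiplies all coefficients of
  \<open>B\<close> into \<open>D\<close>, against the hypothesis on the coefficients.\<close>

lemma ideal_inv_subset_base_ring:
  assumes B: "B \<subseteq> base_ring" "const_fract c \<in> B" "c \<noteq> 0"
    and coeffs: "ideal_inv (coefficients B) \<subseteq> base_ring"
  shows "ideal_inv B \<subseteq> base_ring"
proof
  fix z assume z: "z \<in> ideal_inv B"
  then have "z * const_fract c \<in> base_ring"
    using B(2) unfolding ideal_inv_def by blast
  then have "z \<in> range poly_fract"
    by (rule range_poly_fract_divide_const[OF subsetD[OF base_ring_subset_range_poly_fract] B(3)])
  then obtain h where h: "z = poly_fract h" by auto
  show "z \<in> base_ring"
  proof (rule ccontr)
    assume "z \<notin> base_ring"
    then have "\<not> integral_poly h"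
      by (simp add: h poly_fract_in_base_ring_iff)
    moreover have "integral_poly f" if "f \<in> poly_fract -` B" for f
      using that B(1) unfolding poly_fract_in_base_ring_iff[symmetric] by blast
    moreover have "integral_poly (h * f)" if "f \<in> poly_fract -` B" for f
      using that z unfolding ideal_inv_def h poly_fract_mult poly_fract_in_base_ring_iff[symmetric] by blast
    ultimately obtain e where "e \<notin> base_ring" "\<forall>f\<in>poly_fract -` B. \<forall>i. e * coeff f i \<in> base_ring"
      using McCoy_integral[of "poly_fract -` B" h] by blast
    moreover from this have "e \<in> ideal_inv (coefficients B)"
      unfolding ideal_inv_def coefficients_def by blast
    ultimately show False using coeffs by blast
  qed
qed

text \<open>Multiplying polynomials gives one inclusion. Conversely, the constant \<open>c\<close>
  puts an element of the inverse into \<open>F[X]\<close>, and its products with the constants from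
  \<open>I\<close> show that each coefficient lies in \<open>ideal_inv I\<close>.\<close>

lemma ideal_inv_poly_extension:
  assumes "c \<in> I" "c \<noteq> 0" "0 \<in> I"
  shows "ideal_inv (poly_extension I) = poly_extension (ideal_inv I)"
proof
  show "poly_extension (ideal_inv I) \<subseteq> ideal_inv (poly_extension I)"
  proof
    fix z assume "z \<in> poly_extension (ideal_inv I)"
    then obtain p where p: "z = poly_fract p" "\<And>i. coeff p i \<in> ideal_inv I"
      unfolding poly_extension_def by blast
    have "z * y \<in> base_ring" if y: "y \<in> poly_extension I" for y
    proof -
      obtain q where q: "y = poly_fract q" "\<And>i. coeff q i \<in> I"
        using y unfolding poly_extension_def by blast
      have "coeff p i * coeff q j \<in> base_ring" for i j
        using p(2) q(2) unfolding ideal_inv_def by blast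
      then have "integral_poly (p * q)"
        by (simp add: integral_poly_def coeff_mult fract.subspace_sum[OF subspace_base_ring])
      then show ?thesis
        by (simp only: p(1) q(1) poly_fract_in_base_ring_iff flip: poly_fract_mult)
    qed
    then show "z \<in> ideal_inv (poly_extension I)"
      unfolding ideal_inv_def by blast
  qed
  show "ideal_inv (poly_extension I) \<subseteq> poly_extension (ideal_inv I)"
  proof
    fix z assume z: "z \<in> ideal_inv (poly_extension I)"
    have zI: "z * const_fract a \<in> base_ring" if "a \<in> I" for a
      using z that assms(3) by (simp add: ideal_inv_def const_fract_in_poly_extension_iff)
    have "z \<in> range poly_fract"
      by (rule range_poly_fract_divide_const[OF subsetD[OF base_ring_subset_range_poly_fract zI[OF assms(1)]] assms(2)])
    then obtain h where h: "z = poly_fract h" by auto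
    have "integral_poly (smult a h)" if "a \<in> I" for a
      using zI[OF that] unfolding h poly_fract_in_base_ring_iff[symmetric] poly_fract_smult
      by (simp only: mult.commute)
    then show "z \<in> poly_extension (ideal_inv I)"
      by (simp add: h ideal_inv_def integral_poly_def mult.commute)
  qed
qed

text \<open>The formula for inverses is applied twice; \<open>c\<close> and \<open>d\<close> supply
  the nonzero elements of \<open>I\<close> and of \<open>ideal_inv I\<close>.\<close>

lemma v_closure_poly_extension:
  assumes "c \<in> I" "c \<noteq> 0" "0 \<in> I" "d \<in> ideal_inv I" "d \<noteq> 0"
  shows "v_closure (poly_extension I) = poly_extension (v_closure I)"
  by (simp add: v_closure_def ideal_inv_poly_extension[OF assms(1-3)]
      ideal_inv_poly_extension[OF assms(4,5) fract.subspace_0[OF subspace_ideal_inv]])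

subsection \<open>Extended ideals\<close>

lemma poly_extension_zero [simp]: "poly_extension {0} = {0}"
proof -
  have "{p. \<forall>i. coeff p i \<in> {0}} = {0 :: 'a fract poly}"
    by (auto simp: poly_eq_iff)
  then show ?thesis by (simp add: poly_extension_def)
qed

lemma poly_extension_inj:
  "0 \<in> I \<Longrightarrow> 0 \<in> J \<Longrightarrow> poly_extension I = poly_extension J \<Longrightarrow> I = J"
  using poly_extension_subset_iff[of I J] poly_extension_subset_iff[of J I] by simp

lemma coefficients_subset_base_ring: "B \<subseteq> base_ring \<Longrightarrow> coefficients B \<subseteq> base_ring"
  using coefficients_subset[of B base_ring] by simp

lemma coefficients_nonzero:
  "B \<subseteq> base_ring \<Longrightarrow> \<not> B \<subseteq> {0} \<Longrightarrow> \<not> coefficients B \<subseteq> {0}"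
  using coefficients_subset_iff[OF subset_trans[OF _ base_ring_subset_range_poly_fract], of B "{0}"] by simp

lemma v_closure_poly_extension_integral:
  assumes I: "fract.subspace I" "I \<noteq> {0}" "I \<subseteq> base_ring"
  shows "v_closure (poly_extension I) = poly_extension (v_closure I)"
proof -
  obtain c where "c \<in> I" "c \<noteq> 0" using I fract.subspace_0[OF I(1)] by blast
  then show ?thesis
    using I fract.subspace_0[OF I(1)]
    by (intro v_closure_poly_extension[of c I 1]) (auto simp: ideal_inv_def)
qed

text \<open>\<open>S\<close> lies in \<open>J[X]\<close>, where \<open>J\<close> is generated by its
  coefficients, and the extension commutes with the \<open>v\<close>-closure.\<close>

lemma v_closure_subset_poly_extension:
  assumes "S \<subseteq> base_ring" "\<not> S \<subseteq> {0}"
  shows "v_closure S \<subseteq> poly_extension (v_closure (coefficients S))"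
proof -
  let ?J = "fract.span (coefficients S)"
  have "S \<subseteq> poly_extension ?J"
    by (rule subset_poly_extension_coefficients[OF subset_trans[OF assms(1) base_ring_subset_range_poly_fract]])
  moreover have "?J \<noteq> {0}"
    using coefficients_nonzero[OF assms] by (simp add: span_subset_zero_iff)
  moreover have "?J \<subseteq> base_ring"
    by (rule fract.span_minimal[OF coefficients_subset_base_ring[OF assms(1)] subspace_base_ring])
  ultimately show ?thesis
    using v_closure_mono[of S "poly_extension ?J"] v_closure_poly_extension_integral[of ?J] by simp
qed

text \<open>A finite set of polynomials has finitely many coefficients, so the
  \<open>v\<close>-closure of these is one of the pieces that make up the \<open>t\<close>-closure
  of \<open>I\<close>.\<close>

lemma t_closure_poly_extension_subset:
  assumes I: "fract.subspace I" "I \<subseteq> base_ring"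
  shows "t_closure (poly_extension I) \<subseteq> poly_extension (t_closure I)"
proof
  fix x assume "x \<in> t_closure (poly_extension I)"
  then obtain S where S: "finite S" "\<not> S \<subseteq> {0}" "S \<subseteq> poly_extension I" "x \<in> v_closure S"
    by (rule in_t_closureE)
  have Sb: "S \<subseteq> base_ring"
    using S(3) poly_extension_mono[OF I(2)] by simp
  have "v_closure (coefficients S) \<subseteq> t_closure I"
    using in_t_closureI[OF I(1) finite_coefficients[OF S(1)] coefficients_nonzero[OF Sb S(2)]
      coefficients_subset[OF S(3)]] by blast
  then show "x \<in> poly_extension (t_closure I)"
    using v_closure_subset_poly_extension[OF Sb S(2)] poly_extension_mono S(4) by blast
qed

lemma poly_extension_in_proper_t_ideals:
  assumes I: "I \<in> proper_t_ideals"
  shows "poly_extension I \<in> proper_t_ideals"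
proof -
  note I' = proper_idealsD[OF proper_t_idealsD(1)[OF I]]
  have 0: "0 \<in> I" by (rule fract.subspace_0[OF I'(1)])
  have "I = t_closure I"
    using proper_t_idealsD(2)[OF I] by (simp add: t_ideal_def)
  then have t: "t_closure (poly_extension I) \<subseteq> poly_extension I"
    using t_closure_poly_extension_subset[OF I'(1,3)] by simp
  have nz: "poly_extension I \<noteq> {0}"
    using poly_extension_inj[of I "{0}"] 0 I'(2) by auto
  have "poly_extension I \<in> proper_ideals"
  proof (rule proper_idealsI[OF subspace_poly_extension[OF I'(1)] nz])
    show "poly_extension I \<subseteq> base_ring"
      using poly_extension_mono[OF I'(3)] by simp
    show "1 \<notin> poly_extension I"
      using const_fract_in_poly_extension_iff[OF 0, of 1] I'(4) by simp
  qed
  then show ?thesis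
    using t_idealI[OF _ nz t] by (simp add: proper_t_ideals_def proper_ideals_def)
qed

text \<open>Powers of the indeterminate are scalars of \<open>D[X]\<close>, so generators of a
  module, read as constants, generate its extension. Finite generation thereby carries over to
  \<open>R\<close>.\<close>

lemma poly_extension_span: "poly_extension (fract.span S) = fract.span (const_fract ` S)"
proof
  let ?T = "fract.span (const_fract ` S)"
  have const: "const_fract x \<in> ?T" if "x \<in> fract.span S" for x
    using that
  proof (induction rule: fract.span_induct_alt)
    case base
    then show ?case by (simp add: fract.span_zero)
  next
    case (step c x y)
    then show ?case
      by (simp add: const_fract_add const_fract_mult const_fract_to_fract fract.span_add fract.span_scale fract.span_base)
  qed
  have "poly_fract p \<in> ?T" if "\<forall>i. coeff p i \<in> fract.span S" for p
    using that
  proof (induction p)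
    case 0
    then show ?case by (simp add: fract.span_zero)
  next
    case (pCons a p)
    have "a \<in> fract.span S" "\<forall>i. coeff p i \<in> fract.span S"
      using pCons.prems coeff_pCons_0 coeff_pCons_Suc by metis+
    then show ?case
      using pCons.IH const by (simp add: poly_fract_pCons fract.span_add fract.span_scale)
  qed
  then show "poly_extension (fract.span S) \<subseteq> ?T"
    by (auto simp: poly_extension_def)
  show "?T \<subseteq> poly_extension (fract.span S)"
    by (rule fract.span_minimal)
      (auto simp: const_fract_in_poly_extension_iff fract.span_zero fract.span_base intro: subspace_poly_extension)
qed

text \<open>The extension commutes with the \<open>v\<close>-closure and is injective on submodules,
  so the equation \<open>I = v_closure I\<close> transfers both ways.\<close>

lemma divisorial_poly_extension_iff:
  assumes I: "I \<in> proper_t_ideals"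
  shows "divisorial (poly_extension I) \<longleftrightarrow> divisorial I"
proof -
  note I' = proper_idealsD[OF proper_t_idealsD(1)[OF I]]
  have frac: "fractional_ideal I" "fractional_ideal (poly_extension I)" "I \<noteq> {0}" "poly_extension I \<noteq> {0}"
    using proper_t_idealsD(2)[OF I] proper_t_idealsD(2)[OF poly_extension_in_proper_t_ideals[OF I]]
    by (simp_all add: t_ideal_def)
  have "poly_extension I = poly_extension (v_closure I) \<longleftrightarrow> I = v_closure I"
    using poly_extension_inj[of I "v_closure I"] fract.subspace_0[OF I'(1)]
      fract.subspace_0[OF subspace_v_closure] by auto
  then show ?thesis
    using frac by (simp add: divisorial_def v_closure_poly_extension_integral[OF I'(1,2,3)])
qed

text \<open>On nonzero finitely generated modules the \<open>t\<close>- and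
  \<open>v\<close>-closures agree.\<close>

lemma finite_type_t_ideal_iff:
  "finite_type_t_ideal I \<longleftrightarrow> (\<exists>S. finite S \<and> \<not> S \<subseteq> {0} \<and> I = v_closure S)"
proof
  assume "finite_type_t_ideal I"
  then obtain J where J: "fg_nonzero J" "I = v_closure J"
    using t_closure_fg by (auto simp: finite_type_t_ideal_def)
  then show "\<exists>S. finite S \<and> \<not> S \<subseteq> {0} \<and> I = v_closure S"
    by (metis fg_nonzero_def span_subset_zero_iff v_closure_span)
next
  assume "\<exists>S. finite S \<and> \<not> S \<subseteq> {0} \<and> I = v_closure S"
  then obtain S where S: "finite S" "\<not> S \<subseteq> {0}" "I = v_closure S" by blast
  then have "fg_nonzero (fract.span S)"
    by (auto simp: fg_nonzero_def span_subset_zero_iff)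
  then show "finite_type_t_ideal I"
    using S(3) t_closure_fg[of "fract.span S"] unfolding finite_type_t_ideal_def by auto
qed

text \<open>From \<open>I\<close> to \<open>I[X]\<close>, the finite set is reused as a set of
  constants. In the other direction the coefficients of the finite set are taken: their
  \<open>v\<close>-closure contains \<open>I\<close>, and it lies in \<open>I\<close> because
  \<open>I\<close> is a \<open>t\<close>-ideal.\<close>

lemma finite_type_poly_extension_iff:
  assumes I: "I \<in> proper_t_ideals"
  shows "finite_type_t_ideal (poly_extension I) \<longleftrightarrow> finite_type_t_ideal I"
proof
  note I' = proper_idealsD[OF proper_t_idealsD(1)[OF I]]
  {
    assume "finite_type_t_ideal I"
    then obtain S where S: "finite S" "\<not> S \<subseteq> {0}" "I = v_closure S"
      by (auto simp: finite_type_t_ideal_iff)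
    let ?J = "fract.span S"
    have "?J \<subseteq> I"
      using subset_v_closure[of ?J] S(3) by simp
    then have "v_closure (poly_extension ?J) = poly_extension (v_closure ?J)"
      using I'(3) S(2) by (intro v_closure_poly_extension_integral) (auto simp: span_subset_zero_iff)
    then have "poly_extension I = v_closure (const_fract ` S)"
      using S(3) by (simp add: poly_extension_span)
    moreover have "\<not> const_fract ` S \<subseteq> {0}" "finite (const_fract ` S)"
      using S by auto
    ultimately show "finite_type_t_ideal (poly_extension I)"
      unfolding finite_type_t_ideal_iff by blast
  next
    assume "finite_type_t_ideal (poly_extension I)"
    then obtain S where S: "finite S" "\<not> S \<subseteq> {0}" "poly_extension I = v_closure S"
      by (auto simp: finite_type_t_ideal_iff)
    have SI: "S \<subseteq> poly_extension I" using S(3) subset_v_closure[of S] by simp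
    have Sb: "S \<subseteq> base_ring"
      using SI poly_extension_mono[OF I'(3)] by simp
    note nz = coefficients_nonzero[OF Sb S(2)]
    have "poly_extension I \<subseteq> poly_extension (v_closure (coefficients S))"
      using v_closure_subset_poly_extension[OF Sb S(2)] S(3) by simp
    then have "I \<subseteq> v_closure (coefficients S)"
      using poly_extension_subset_iff[of I] fract.subspace_0[OF I'(1)] fract.subspace_0[OF subspace_v_closure]
      by blast
    moreover have "v_closure (coefficients S) \<subseteq> I"
      by (intro v_closure_subset_t_ideal proper_t_idealsD(2)[OF I] finite_coefficients S nz
          coefficients_subset SI)
    ultimately show "finite_type_t_ideal I"
      using finite_coefficients[OF S(1)] nz unfolding finite_type_t_ideal_iff by blast
  }
qed

text \<open>A finite witness \<open>S\<close> in the product for \<open>I\<close> becomes a set of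
  constants in the product for \<open>I[X]\<close>, with inverse the extension of
  \<open>ideal_inv S\<close>. Conversely, the product for \<open>I[X]\<close> lies in the extension
  of the product for \<open>I\<close>, and the constant coefficient of \<open>1\<close> carries the
  claim down.\<close>

lemma t_invertible_poly_extension_iff:
  assumes I: "I \<in> proper_t_ideals"
  shows "t_invertible (poly_extension I) \<longleftrightarrow> t_invertible I"
proof -
  note I' = proper_idealsD[OF proper_t_idealsD(1)[OF I]]
  have frac: "fractional_ideal I" "fractional_ideal (poly_extension I)" "poly_extension I \<noteq> {0}"
    using proper_t_idealsD(2)[OF I] proper_t_idealsD(2)[OF poly_extension_in_proper_t_ideals[OF I]]
    by (simp_all add: t_ideal_def)
  have 0: "0 \<in> I" by (rule fract.subspace_0[OF I'(1)])
  obtain c where c: "c \<in> I" "c \<noteq> 0" using 0 I'(2) by blast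
  let ?P = "ideal_prod I (ideal_inv I)"
  let ?Q = "ideal_prod (poly_extension I) (ideal_inv (poly_extension I))"
  have inv: "ideal_inv (poly_extension I) = poly_extension (ideal_inv I)"
    by (rule ideal_inv_poly_extension[OF c 0])
  have Psub: "fract.subspace ?P" by (simp add: ideal_prod_def)
  have Qsub: "fract.subspace ?Q" by (simp add: ideal_prod_def)
  have prodP: "x * y \<in> ?P" if "x \<in> I" "y \<in> ideal_inv I" for x y
    using that unfolding ideal_prod_def by (intro fract.span_base) blast
  have prodQ: "x * y \<in> ?Q" if "x \<in> poly_extension I" "y \<in> poly_extension (ideal_inv I)" for x y
    using that unfolding ideal_prod_def inv by (intro fract.span_base) blast
  have "1 \<in> t_closure ?Q" if 1: "1 \<in> t_closure ?P"
  proof -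
    obtain S where S: "finite S" "\<not> S \<subseteq> {0}" "S \<subseteq> ?P" "1 \<in> v_closure S"
      using 1 by (rule in_t_closureE)
    have "?P \<subseteq> {x. const_fract x \<in> ?Q}"
      unfolding ideal_prod_def[of I]
    proof (rule fract.span_minimal)
      show "{x * y |x y. x \<in> I \<and> y \<in> ideal_inv I} \<subseteq> {x. const_fract x \<in> ?Q}"
        using prodQ const_fract_in_poly_extension_iff[OF 0]
          const_fract_in_poly_extension_iff[OF fract.subspace_0[OF subspace_ideal_inv[of I]]]
        by (auto simp: const_fract_mult)
      show "fract.subspace {x. const_fract x \<in> ?Q}"
        by (rule fract.subspaceI)
          (simp_all add: fract.subspace_0[OF Qsub] const_fract_add fract.subspace_add[OF Qsub]
            const_fract_mult const_fract_to_fract fract.subspace_scale[OF Qsub])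
    qed
    then have sub: "const_fract ` S \<subseteq> ?Q" using S(3) by blast
    have "ideal_inv (const_fract ` S) = ideal_inv (poly_extension (fract.span S))"
      by (simp add: poly_extension_span)
    also have "\<dots> = poly_extension (ideal_inv S)"
    proof -
      obtain s where "s \<in> S" "s \<noteq> 0" using S(2) by blast
      then show ?thesis
        using ideal_inv_poly_extension[of s "fract.span S"] by (simp add: fract.span_base fract.span_zero)
    qed
    also have "\<dots> \<subseteq> base_ring"
      using S(4) poly_extension_mono[of "ideal_inv S" base_ring] by (simp add: one_in_v_closure_iff)
    finally have "1 \<in> v_closure (const_fract ` S)" by (simp add: one_in_v_closure_iff)
    moreover have "finite (const_fract ` S)" "\<not> const_fract ` S \<subseteq> {0}" using S by auto
    ultimately show ?thesis using in_t_closureI[OF Qsub _ _ sub] by blast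
  qed
  moreover have "1 \<in> t_closure ?P" if 1: "1 \<in> t_closure ?Q"
  proof -
    have "?Q \<subseteq> poly_extension ?P"
      unfolding inv ideal_prod_def[of "poly_extension I"]
    proof (rule fract.span_minimal[OF _ subspace_poly_extension[OF Psub]])
      have "poly_fract p * poly_fract q \<in> poly_extension ?P"
        if "\<forall>i. coeff p i \<in> I" "\<forall>i. coeff q i \<in> ideal_inv I" for p q
        using that prodP by (simp add: coeff_mult fract.subspace_sum[OF Psub] flip: poly_fract_mult)
      then show "{x * y |x y. x \<in> poly_extension I \<and> y \<in> poly_extension (ideal_inv I)} \<subseteq> poly_extension ?P"
        unfolding poly_extension_def[of I] poly_extension_def[of "ideal_inv I"] by blast
    qed
    then have "1 \<in> poly_extension (t_closure ?P)"
      using 1 t_closure_mono[of ?Q "poly_extension ?P"]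
        t_closure_poly_extension_subset[OF Psub ideal_prod_inv_subset] by blast
    then have "coeff 1 0 \<in> t_closure ?P"
      using poly_fract_in_poly_extension_iff[of 1 "t_closure ?P"] by (simp del: coeff_1)
    then show ?thesis by simp
  qed
  ultimately show ?thesis
    using frac I'(2) by (auto simp: t_invertible_iff)
qed

subsection \<open>Contents of \<open>t\<close>-ideals\<close>

text \<open>Finiteness enters three times: in the \<open>t\<close>-closure, in the span, and in the
  choice of polynomials realising the coefficients.\<close>

lemma finite_subset_unit_content:
  assumes Q: "Q \<subseteq> base_ring" and 1: "1 \<in> t_closure (fract.span (coefficients Q))"
  obtains B where "finite B" "B \<subseteq> Q" "ideal_inv (coefficients B) \<subseteq> base_ring"
proof -
  obtain S where S: "finite S" "S \<subseteq> fract.span (coefficients Q)" "1 \<in> v_closure S"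
    using 1 by (rule in_t_closureE)
  obtain V where V: "finite V" "V \<subseteq> coefficients Q" "S \<subseteq> fract.span V"
    using S(1,2) by (rule span_finite_subset)
  obtain B where B: "finite B" "B \<subseteq> Q" "V \<subseteq> coefficients B"
    using V(1,2) by (rule finite_subset_coefficients)
  have "ideal_inv (coefficients B) \<subseteq> ideal_inv V"
    by (rule ideal_inv_antimono[OF B(3)])
  also have "\<dots> \<subseteq> ideal_inv S"
    using ideal_inv_antimono[OF V(3)] by simp
  also have "\<dots> \<subseteq> base_ring"
    using S(3) by (simp add: one_in_v_closure_iff)
  finally show thesis by (rule that[OF B(1,2)])
qed

text \<open>Otherwise a finite part \<open>B\<close> of \<open>Q\<close> would already have unit
  content. Adjoining \<open>c\<close> would give a finite subset of \<open>Q\<close> with inverse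
  inside \<open>R\<close>; its \<open>v\<close>-closure contains \<open>1\<close> and lies in the
  \<open>t\<close>-ideal \<open>Q\<close>.\<close>

lemma content_proper:
  assumes Q: "Q \<in> proper_t_ideals" and c: "const_fract c \<in> Q" "c \<noteq> 0"
  shows "1 \<notin> t_closure (fract.span (coefficients Q))"
proof
  note Q' = proper_idealsD[OF proper_t_idealsD(1)[OF Q]]
  assume "1 \<in> t_closure (fract.span (coefficients Q))"
  with Q'(3) obtain B where B: "finite B" "B \<subseteq> Q" "ideal_inv (coefficients B) \<subseteq> base_ring"
    by (rule finite_subset_unit_content)
  let ?B = "insert (const_fract c) B"
  have BQ: "?B \<subseteq> Q" using B(2) c(1) by simp
  have "ideal_inv (coefficients ?B) \<subseteq> base_ring"
    using B(3) ideal_inv_antimono[OF coefficients_mono[of B ?B]] by blast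
  then have "ideal_inv ?B \<subseteq> base_ring"
    using BQ Q'(3) c(2) by (intro ideal_inv_subset_base_ring[of _ c]) auto
  moreover have "\<not> ?B \<subseteq> {0}" using c(2) by simp
  ultimately have "1 \<in> Q"
    using v_closure_subset_t_ideal[OF proper_t_idealsD(2)[OF Q] _ _ BQ] B(1) one_in_v_closure_iff[of ?B]
    by blast
  then show False using Q'(4) by blast
qed

lemma t_closure_content_in_proper_t_ideals:
  assumes Q: "Q \<in> proper_t_ideals" and 1: "1 \<notin> t_closure (fract.span (coefficients Q))"
  shows "t_closure (fract.span (coefficients Q)) \<in> proper_t_ideals"
    and "Q \<subseteq> poly_extension (t_closure (fract.span (coefficients Q)))"
proof -
  let ?C = "fract.span (coefficients Q)"
  note Q' = proper_idealsD[OF proper_t_idealsD(1)[OF Q]]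
  have "\<not> Q \<subseteq> {0}" using Q'(2) fract.subspace_0[OF Q'(1)] by blast
  then have nz: "?C \<noteq> {0}"
    using coefficients_nonzero[OF Q'(3)] by (simp add: span_subset_zero_iff)
  moreover have "?C \<subseteq> base_ring"
    by (intro fract.span_minimal coefficients_subset_base_ring Q'(3) subspace_base_ring)
  ultimately show "t_closure ?C \<in> proper_t_ideals"
    using 1 by (intro t_closure_in_proper_t_ideals) simp_all
  have "Q \<subseteq> poly_extension ?C"
    by (rule subset_poly_extension_coefficients[OF subset_trans[OF Q'(3) base_ring_subset_range_poly_fract]])
  also have "\<dots> \<subseteq> poly_extension (t_closure ?C)"
    using nz by (intro poly_extension_mono subset_t_closure) simp_all
  finally show "Q \<subseteq> poly_extension (t_closure ?C)" .
qed

text \<open>\<open>Q\<close> generates a principal ideal of \<open>F[X]\<close>, and a nonzero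
  element of \<open>Q\<close> of minimal degree generates it. The cofactor \<open>k\<close> is only
  known to lie in \<open>F[X]\<close>.\<close>

lemma ex_generator_over_field:
  assumes Q: "fract.subspace (Q :: 'a::idom poly fract set)" "Q \<noteq> {0}" "Q \<subseteq> base_ring"
  obtains g where "g \<in> Q" "g \<noteq> 0" "\<And>q. q \<in> Q \<Longrightarrow> \<exists>k. q = g * poly_fract k"
proof -
  define A where "A = {g. g \<noteq> 0 \<and> to_fract g \<in> Q}"
  obtain x where x: "x \<in> Q" "x \<noteq> 0" using Q(2) fract.subspace_0[OF Q(1)] by blast
  then obtain g0 where g0: "x = to_fract g0" using Q(3) by blast
  then have "g0 \<in> A" using x by (auto simp: A_def)
  then obtain g where g: "g \<in> A" and min: "\<And>h. h \<in> A \<Longrightarrow> degree g \<le> degree h"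
    using ex_has_least_nat[of "\<lambda>h. h \<in> A" g0 degree] by blast
  show thesis
  proof (rule that)
    show "to_fract g \<in> Q" "to_fract g \<noteq> 0" using g by (simp_all add: A_def)
    fix q assume q: "q \<in> Q"
    then obtain q' where q': "q = to_fract q'" using Q(3) by blast
    define k where "k = fract_poly q' div fract_poly g"
    define r where "r = fract_poly q' mod fract_poly g"
    have qr: "fract_poly q' = fract_poly g * k + r"
      by (simp add: k_def r_def)
    obtain d where d: "d \<noteq> 0" "integral_poly (smult (to_fract d) k)"
      by (rule clear_denominators)
    obtain k' where k': "smult (to_fract d) k = fract_poly k'"
      using d(2) by (rule integral_polyE)
    \<comment> \<open>The remainder times the denominator \<open>d\<close> of the quotient. As a
      combination of \<open>q'\<close> and \<open>g\<close> over \<open>R\<close> it lies in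
      \<open>Q\<close>, so minimality of the degree of \<open>g\<close> forces it to vanish.\<close>
    define r' where "r' = smult d q' - g * k'"
    have "fract_poly r' = smult (to_fract d) (fract_poly q') - fract_poly g * smult (to_fract d) k"
      by (simp add: r'_def k')
    then have r': "fract_poly r' = smult (to_fract d) r"
      by (simp add: qr smult_add_right)
    have "r = 0"
    proof (rule ccontr)
      assume "r \<noteq> 0"
      then have "degree r < degree (fract_poly g)"
        unfolding r_def using g by (intro degree_mod_less') (auto simp: A_def)
      then have "degree r < degree g"
        by (simp add: degree_map_poly)
      moreover have "degree r' = degree r"
        using arg_cong[OF r', of degree] d(1) by (simp add: degree_map_poly)
      moreover have "r' \<noteq> 0"
        using r' \<open>r \<noteq> 0\<close> d(1) by auto
      moreover have "to_fract r' \<in> Q"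
      proof -
        have "r' = [:d:] * q' - k' * g" by (simp add: r'_def)
        then have "to_fract r' = to_fract [:d:] * q - to_fract k' * to_fract g"
          by (simp only: q' to_fract_diff to_fract_mult)
        then show ?thesis
          using q g by (simp add: A_def fract.subspace_diff[OF Q(1)] fract.subspace_scale[OF Q(1)])
      qed
      ultimately show False using min[of r'] by (simp add: A_def)
    qed
    then have "q = to_fract g * poly_fract k"
      using arg_cong[OF qr, of poly_fract] by (simp add: q' poly_fract_fract_poly poly_fract_mult)
    then show "\<exists>k. q = to_fract g * poly_fract k" by blast
  qed
qed

text \<open>Up to constant denominators every element of \<open>Q\<close> is a multiple of
  \<open>g\<close>, and a finite set \<open>B\<close> of unit content makes such denominators
  disappear.\<close>

lemma unit_content_t_invertible:
  assumes Q: "Q \<in> proper_t_ideals" and 1: "1 \<in> t_closure (fract.span (coefficients Q))"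
  shows "t_invertible Q" "finite_type_t_ideal Q" "divisorial Q"
proof -
  note Q' = proper_idealsD[OF proper_t_idealsD(1)[OF Q]]
  have Qt: "t_ideal Q" by (rule proper_t_idealsD(2)[OF Q])
  obtain B where B: "finite B" "B \<subseteq> Q" "ideal_inv (coefficients B) \<subseteq> base_ring"
    using Q'(3) 1 by (rule finite_subset_unit_content)
  obtain g where g: "g \<in> Q" "g \<noteq> 0" and gen: "\<And>q. q \<in> Q \<Longrightarrow> \<exists>k. q = g * poly_fract k"
    using ex_generator_over_field[OF Q'(1-3)] by blast
  have Bb: "B \<subseteq> base_ring" using B(2) Q'(3) by blast
  \<comment> \<open>Adjoining the constant \<open>b\<close> to \<open>B\<close> gives a set with
    inverse inside \<open>R\<close>, so an element is integral once its products with
    \<open>b\<close> and with all of \<open>B\<close> are.\<close>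
  have key: "z \<in> base_ring"
    if "\<And>f. f \<in> B \<Longrightarrow> z * f \<in> base_ring" "z * to_fract [:b:] \<in> base_ring" "b \<noteq> 0" for z b
  proof -
    let ?B = "insert (to_fract [:b:]) B"
    have "ideal_inv (coefficients ?B) \<subseteq> base_ring"
      using B(3) ideal_inv_antimono[OF coefficients_mono[of B ?B]] by blast
    then have "ideal_inv ?B \<subseteq> base_ring"
      using Bb that(3) by (intro ideal_inv_subset_base_ring[of _ "to_fract b"]) (auto simp: const_fract_to_fract)
    moreover have "z \<in> ideal_inv ?B"
      using that by (auto simp: ideal_inv_def)
    ultimately show ?thesis by blast
  qed
  define J where "J = insert g B"
  have JQ: "J \<subseteq> Q" "finite J" "\<not> J \<subseteq> {0}"
    using B g by (auto simp: J_def)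
  have vJ: "Q = v_closure J"
  proof
    show "v_closure J \<subseteq> Q"
      by (rule v_closure_subset_t_ideal[OF Qt JQ(2,3,1)])
    show "Q \<subseteq> v_closure J"
    proof
      fix q assume q: "q \<in> Q"
      then obtain k where k: "q = g * poly_fract k" using gen by blast
      obtain b where b: "b \<noteq> 0" "integral_poly (smult (to_fract b) k)"
        by (rule clear_denominators)
      \<comment> \<open>\<open>q * y\<close> passes the test against \<open>B\<close> because
        \<open>y\<close> is in the inverse of \<open>B\<close>, and against the denominator
        \<open>b\<close> of \<open>k\<close> because \<open>y * g\<close> is integral.\<close>
      have "q * y \<in> base_ring" if y: "y \<in> ideal_inv J" for y
      proof (rule key[OF _ _ b(1)])
        have yJ: "y * f \<in> base_ring" if "f \<in> J" for f
          using y that unfolding ideal_inv_def by blast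
        show "q * y * f \<in> base_ring" if "f \<in> B" for f
          using to_fract_mult_in_base_ring[OF subsetD[OF Q'(3) q] yJ[of f]] that by (simp add: J_def mult.assoc)
        have "q * y * to_fract [:b:] = (y * g) * poly_fract (smult (to_fract b) k)"
          by (simp add: k poly_fract_smult const_fract_to_fract mult_ac)
        moreover have "\<dots> \<in> base_ring"
          using b(2) yJ[of g] by (intro to_fract_mult_in_base_ring[of "y * g"]) (simp_all add: J_def poly_fract_in_base_ring_iff)
        ultimately show "q * y * to_fract [:b:] \<in> base_ring" by (simp only:)
      qed
      then show "q \<in> v_closure J"
        unfolding v_closure_def ideal_inv_def[of "ideal_inv J"] by blast
    qed
  qed
  show fin: "finite_type_t_ideal Q"
    using JQ vJ unfolding finite_type_t_ideal_iff by blast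
  have frac: "fractional_ideal Q" using Qt by (simp add: t_ideal_def)
  show "divisorial Q"
    using frac Q'(2) vJ unfolding divisorial_def by (metis v_closure_idem)
  \<comment> \<open>A common constant denominator \<open>b\<close> of the quotients
    \<open>f / g\<close> places \<open>b / g\<close> in the inverse of \<open>Q\<close>, so that
    \<open>b\<close> lies in the product of \<open>Q\<close> with its inverse.\<close>
  have "\<exists>b. b \<noteq> 0 \<and> (\<forall>f\<in>J. to_fract [:b:] * (f / g) \<in> base_ring)"
    using JQ(2,1)
  proof (induction J)
    case empty
    show ?case by (intro exI[of _ 1]) simp
  next
    case (insert f J)
    then obtain b where b: "b \<noteq> 0" "\<forall>f\<in>J. to_fract [:b:] * (f / g) \<in> base_ring" by auto
    obtain k where k: "f = g * poly_fract k" using gen insert.prems by blast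
    obtain d where d: "d \<noteq> 0" "integral_poly (smult (to_fract d) k)"
      by (rule clear_denominators)
    have bd: "to_fract [:b * d:] = to_fract [:b:] * to_fract [:d:]"
      by (simp flip: to_fract_mult)
    have "to_fract [:d:] * (f / g) \<in> base_ring"
      using d(2) g(2) by (simp add: k const_fract_to_fract poly_fract_smult flip: poly_fract_in_base_ring_iff)
    then have "to_fract [:b * d:] * (f / g) \<in> base_ring"
      unfolding bd mult.assoc by (rule fract.subspace_scale[OF subspace_base_ring])
    moreover have "to_fract [:b * d:] * (f' / g) \<in> base_ring" if "f' \<in> J" for f'
      using fract.subspace_scale[OF subspace_base_ring bspec[OF b(2) that], of "[:d:]"]
      unfolding bd by (simp only: mult_ac)
    ultimately show ?case
      using b(1) d(1) by (intro exI[of _ "b * d"]) simp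
  qed
  then obtain b where b: "b \<noteq> 0" "\<And>f. f \<in> J \<Longrightarrow> to_fract [:b:] * (f / g) \<in> base_ring" by blast
  have inv: "ideal_inv Q = ideal_inv J" unfolding vJ by simp
  let ?P = "ideal_prod Q (ideal_inv Q)"
  have prod: "x * y \<in> ?P" if "x \<in> Q" "y \<in> ideal_inv Q" for x y
    using that unfolding ideal_prod_def by (intro fract.span_base) blast
  \<comment> \<open>The finite witness for \<open>t\<close>-invertibility; \<open>B\<close> lies in
    the product because \<open>1\<close> is in the inverse of \<open>Q\<close>.\<close>
  let ?B = "insert (to_fract [:b:]) B"
  have "to_fract [:b:] / g \<in> ideal_inv Q"
    using b(2) unfolding inv unfolding ideal_inv_def by simp
  then have "to_fract [:b:] \<in> ?P"
    using prod[OF g(1), of "to_fract [:b:] / g"] g(2) by simp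
  moreover have "1 \<in> ideal_inv Q"
    using Q'(3) by (auto simp: ideal_inv_def)
  then have "B \<subseteq> ?P"
    using prod B(2) by (metis mult.right_neutral subset_iff)
  ultimately have BP: "?B \<subseteq> ?P" by simp
  have "ideal_inv ?B \<subseteq> base_ring"
  proof
    fix z assume "z \<in> ideal_inv ?B"
    then show "z \<in> base_ring"
      using b(1) by (intro key[of z b]) (simp_all add: ideal_inv_def)
  qed
  then have "1 \<in> t_closure ?P"
    using B(1) b(1) BP by (intro in_t_closureI[of ?P ?B]) (simp_all add: ideal_prod_def one_in_v_closure_iff)
  then show "t_invertible Q"
    by (simp add: t_invertible_iff[OF frac Q'(2)])
qed

section \<open>Covering properties of \<open>D\<close> and of \<open>R\<close>\<close>

text \<open>The hypotheses isolate what the three properties in (2) share: transfer along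
  \<open>I[X]\<close>, and validity for \<open>t\<close>-ideals of unit content. If the content of
  \<open>Q\<close> is proper, the extension of an ideal covering the content covers
  \<open>Q\<close>.\<close>

lemma every_contained_in_poly_iff:
  assumes ext: "\<And>I. I \<in> proper_t_ideals \<Longrightarrow> P' (poly_extension I) \<longleftrightarrow> P I"
    and unit: "\<And>Q. Q \<in> proper_t_ideals \<Longrightarrow> 1 \<in> t_closure (fract.span (coefficients Q)) \<Longrightarrow> P' Q"
  shows "proper_t_ideals \<lhd> P \<longleftrightarrow> proper_t_ideals \<lhd> P'"
proof
  assume P: "proper_t_ideals \<lhd> P"
  show "proper_t_ideals \<lhd> P'"
    unfolding every_contained_in_def
  proof
    fix Q :: "'a poly fract set" assume Q: "Q \<in> proper_t_ideals"
    let ?C = "t_closure (fract.span (coefficients Q))"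
    show "\<exists>\<gamma>\<in>proper_t_ideals. Q \<subseteq> \<gamma> \<and> P' \<gamma>"
    proof (cases "1 \<in> ?C")
      case True
      then show ?thesis using Q unit by blast
    next
      case False
      note C = t_closure_content_in_proper_t_ideals[OF Q False]
      obtain I where I: "I \<in> proper_t_ideals" "?C \<subseteq> I" "P I"
        using P C(1) unfolding every_contained_in_def by blast
      have "Q \<subseteq> poly_extension I"
        using C(2) poly_extension_mono[OF I(2)] by blast
      then show ?thesis
        using poly_extension_in_proper_t_ideals[OF I(1)] ext I by blast
    qed
  qed
next
  assume P': "proper_t_ideals \<lhd> P'"
  show "proper_t_ideals \<lhd> P"
    unfolding every_contained_in_def
  proof
    fix I :: "'a fract set" assume I: "I \<in> proper_t_ideals"
    \<comment> \<open>Maximality leaves no choice for the ideal \<open>Q\<close> covering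
      \<open>M[X]\<close>: its content is a proper \<open>t\<close>-ideal containing
      \<open>M\<close>, hence \<open>M\<close>, and so \<open>Q\<close> is \<open>M[X]\<close>
      itself.\<close>
    obtain M where M: "M \<in> proper_t_ideals" "I \<subseteq> M"
      and max: "\<And>N. N \<in> proper_t_ideals \<Longrightarrow> M \<subseteq> N \<Longrightarrow> N = M"
      using ex_maximal_proper_t_ideal[OF I] by blast
    note M' = proper_idealsD[OF proper_t_idealsD(1)[OF M(1)]]
    have 0: "0 \<in> M" by (rule fract.subspace_0[OF M'(1)])
    obtain Q where Q: "Q \<in> proper_t_ideals" "poly_extension M \<subseteq> Q" "P' Q"
      using P' poly_extension_in_proper_t_ideals[OF M(1)] unfolding every_contained_in_def by blast
    have const: "const_fract x \<in> Q" if "x \<in> M" for x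
      using Q(2) that const_fract_in_poly_extension_iff[OF 0] by blast
    obtain c where c: "c \<in> M" "c \<noteq> 0" using 0 M'(2) by blast
    let ?C = "t_closure (fract.span (coefficients Q))"
    have 1: "1 \<notin> ?C"
      by (rule content_proper[OF Q(1) const[OF c(1)] c(2)])
    note C = t_closure_content_in_proper_t_ideals[OF Q(1) 1]
    have "M \<subseteq> ?C"
    proof
      fix x assume "x \<in> M"
      then have "const_fract x \<in> poly_extension ?C" using const C(2) by blast
      then show "x \<in> ?C"
        using const_fract_in_poly_extension_iff[OF fract.subspace_0[OF proper_idealsD(1)[OF proper_t_idealsD(1)[OF C(1)]]]]
        by blast
    qed
    then have "?C = M" by (rule max[OF C(1)])
    then have "Q = poly_extension M"
      using C(2) Q(2) by simp
    then show "\<exists>\<gamma>\<in>proper_t_ideals. I \<subseteq> \<gamma> \<and> P \<gamma>"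
      using M Q(3) ext by blast
  qed
qed

text \<open>An element of the inverse of \<open>{a, X}\<close> is a polynomial over \<open>F\<close>
  because of \<open>a\<close>, and integral because of \<open>X\<close>. Hence the
  \<open>v\<close>-closure contains \<open>1\<close>, and an ideal satisfying \<open>P\<close> above
  \<open>(a, X)\<close> cannot be proper.\<close>

lemma not_every_contained_in_poly:
  fixes a :: "'a::idom"
  assumes a: "a \<noteq> 0" "\<not> a dvd 1"
    and P: "\<And>I S. I \<in> (proper_ideals :: 'a poly fract set set) \<Longrightarrow> P I \<Longrightarrow> finite S \<Longrightarrow> \<not> S \<subseteq> {0} \<Longrightarrow>
      S \<subseteq> I \<Longrightarrow> v_closure S \<subseteq> I"
  shows "\<not> proper_ideals \<lhd> P"
proof
  assume cov: "proper_ideals \<lhd> P"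
  let ?S = "{to_fract [:a:], to_fract [:0, 1:]}"
  have span: "\<exists>u v. x = to_fract (u * [:a:] + v * [:0, 1:])" if "x \<in> fract.span ?S" for x
    using that by (auto simp: fract.span_insert eq_diff_eq diff_eq_eq add_ac simp del: mult_pCons_right)
  have "fract.span ?S \<in> proper_ideals"
  proof (rule proper_idealsI[OF fract.subspace_span])
    show "fract.span ?S \<noteq> {0}" using a by (simp add: span_subset_zero_iff)
    show "fract.span ?S \<subseteq> base_ring" by (rule fract.span_minimal[OF _ subspace_base_ring]) auto
    show "1 \<notin> fract.span ?S"
    proof
      assume "1 \<in> fract.span ?S"
      then obtain u v where "to_fract 1 = to_fract (u * [:a:] + v * [:0, 1:])"
        using span[of 1] by auto
      \<comment> \<open>In the constant coefficient the multiple of \<open>X\<close> contributes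
        nothing, so \<open>a\<close> would divide \<open>1\<close>.\<close>
      then have "coeff 1 0 = coeff (u * [:a:] + v * [:0, 1:]) 0"
        by (simp only: to_fract_eq_iff)
      then have "1 = a * coeff u 0" by (simp add: coeff_mult mult.commute)
      then show False using a(2) by (metis dvd_triv_left)
    qed
  qed
  then obtain I where I: "I \<in> proper_ideals" "fract.span ?S \<subseteq> I" "P I"
    using cov unfolding every_contained_in_def by blast
  have "v_closure ?S \<subseteq> I"
    using a(1) by (intro P[OF I(1,3)]) (use fract.span_superset[of ?S] I(2) in auto)
  moreover have "ideal_inv ?S \<subseteq> base_ring"
  proof
    fix z assume z: "z \<in> ideal_inv ?S"
    then have "z * const_fract (to_fract a) \<in> base_ring"
      by (simp add: ideal_inv_def const_fract_to_fract)
    moreover have "to_fract a \<noteq> 0" using a(1) by simp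
    ultimately have "z \<in> range poly_fract"
      by (rule range_poly_fract_divide_const[OF subsetD[OF base_ring_subset_range_poly_fract]])
    then obtain h where h: "z = poly_fract h" by auto
    \<comment> \<open>Multiplication by \<open>X\<close> only shifts coefficients, so integrality of
      \<open>X * h\<close> gives that of \<open>h\<close>.\<close>
    have "poly_fract (pCons 0 h) \<in> base_ring"
      using z by (simp add: h poly_fract_pCons ideal_inv_def mult.commute)
    then have "\<forall>i. coeff (pCons 0 h) i \<in> base_ring"
      unfolding poly_fract_in_base_ring_iff integral_poly_def .
    then have "coeff h i \<in> base_ring" for i
      by (drule_tac x = "Suc i" in spec) simp
    then show "z \<in> base_ring"
      unfolding h poly_fract_in_base_ring_iff integral_poly_def by blast
  qed
  ultimately have "1 \<in> I" using one_in_v_closure_iff[of ?S] by blast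
  then show False using proper_idealsD(4)[OF I(1)] by blast
qed

theorem proposition2:
  assumes not_field: "\<exists>a::'a::idom. a \<noteq> 0 \<and> \<not> a dvd 1"
  shows
    "(((proper_ideals :: 'a fract set set) \<lhd> (\<lambda>I. proper_nonzero I \<and> principal_ideal I) \<longrightarrow>
        \<not> (proper_ideals :: 'a poly fract set set) \<lhd> (\<lambda>I. proper_nonzero I \<and> principal_ideal I)) \<and>
      ((proper_ideals :: 'a fract set set) \<lhd> (\<lambda>I. proper_nonzero I \<and> t_invertible I \<and> t_ideal I) \<longrightarrow>
        \<not> (proper_ideals :: 'a poly fract set set) \<lhd> (\<lambda>I. proper_nonzero I \<and> t_invertible I \<and> t_ideal I)) \<and>
      ((proper_ideals :: 'a fract set set) \<lhd> (\<lambda>I. proper_nonzero I \<and> t_ideal I) \<longrightarrow>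
        \<not> (proper_ideals :: 'a poly fract set set) \<lhd> (\<lambda>I. proper_nonzero I \<and> t_ideal I)) \<and>
      ((proper_ideals :: 'a fract set set) \<lhd> (\<lambda>I. proper_nonzero I \<and> finite_type_t_ideal I) \<longrightarrow>
        \<not> (proper_ideals :: 'a poly fract set set) \<lhd> (\<lambda>I. proper_nonzero I \<and> finite_type_t_ideal I)) \<and>
      ((proper_ideals :: 'a fract set set) \<lhd> (\<lambda>I. proper_nonzero I \<and> divisorial I) \<longrightarrow>
        \<not> (proper_ideals :: 'a poly fract set set) \<lhd> (\<lambda>I. proper_nonzero I \<and> divisorial I))) \<and>
     (((proper_t_ideals :: 'a fract set set) \<lhd> (\<lambda>I. t_invertible I \<and> t_ideal I) \<longleftrightarrow>
        (proper_t_ideals :: 'a poly fract set set) \<lhd> (\<lambda>I. t_invertible I \<and> t_ideal I)) \<and>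
      ((proper_t_ideals :: 'a fract set set) \<lhd> finite_type_t_ideal \<longleftrightarrow>
        (proper_t_ideals :: 'a poly fract set set) \<lhd> finite_type_t_ideal) \<and>
      ((proper_t_ideals :: 'a fract set set) \<lhd> divisorial \<longleftrightarrow>
        (proper_t_ideals :: 'a poly fract set set) \<lhd> divisorial))"
proof -
  obtain a :: 'a where a: "a \<noteq> 0" "\<not> a dvd 1" using not_field by blast
  note not_cover = not_every_contained_in_poly[OF a]
  have "\<not> proper_ideals \<lhd> (\<lambda>I :: 'a poly fract set. proper_nonzero I \<and> principal_ideal I)"
  proof (rule not_cover)
    fix I S :: "'a poly fract set"
    assume I: "I \<in> proper_ideals" "proper_nonzero I \<and> principal_ideal I" and S: "S \<subseteq> I"
    then obtain b where b: "I = fract.span {b}" by (auto simp: principal_ideal_def)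
    with proper_idealsD(2)[OF I(1)] have "b \<noteq> 0" by (auto simp: span_subset_zero_iff)
    then show "v_closure S \<subseteq> I"
      using v_closure_mono[OF S] v_closure_singleton[of b] b by simp
  qed
  moreover have t: "\<not> proper_ideals \<lhd> (\<lambda>I :: 'a poly fract set. proper_nonzero I \<and> t_ideal I)"
    by (rule not_cover) (use v_closure_subset_t_ideal in blast)
  \<comment> \<open>Adding \<open>t_invertible\<close> narrows the choice of covering ideals, so the
    failure for \<open>t\<close>-ideals carries over.\<close>
  moreover have "\<not> proper_ideals \<lhd> (\<lambda>I :: 'a poly fract set. proper_nonzero I \<and> t_invertible I \<and> t_ideal I)"
    using t unfolding every_contained_in_def by blast
  moreover have "\<not> proper_ideals \<lhd> (\<lambda>I :: 'a poly fract set. proper_nonzero I \<and> finite_type_t_ideal I)"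
  proof (rule not_cover)
    fix I S :: "'a poly fract set"
    assume "proper_nonzero I \<and> finite_type_t_ideal I" and S: "S \<subseteq> I"
    then obtain T where "I = v_closure T" by (auto simp: finite_type_t_ideal_iff)
    then show "v_closure S \<subseteq> I" using S by (simp add: v_closure_subset_iff)
  qed
  moreover have "\<not> proper_ideals \<lhd> (\<lambda>I :: 'a poly fract set. proper_nonzero I \<and> divisorial I)"
  proof (rule not_cover)
    fix I S :: "'a poly fract set"
    assume "proper_nonzero I \<and> divisorial I" and S: "S \<subseteq> I"
    then have "I = v_closure I" by (simp add: divisorial_def)
    then show "v_closure S \<subseteq> I" using v_closure_mono[OF S] by simp
  qed
  moreover have "(proper_t_ideals :: 'a fract set set) \<lhd> (\<lambda>I. t_invertible I \<and> t_ideal I) \<longleftrightarrow>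
      (proper_t_ideals :: 'a poly fract set set) \<lhd> (\<lambda>I. t_invertible I \<and> t_ideal I)"
    by (rule every_contained_in_poly_iff)
      (simp_all add: t_invertible_poly_extension_iff poly_extension_in_proper_t_ideals
        proper_t_idealsD(2) unit_content_t_invertible(1))
  moreover have "(proper_t_ideals :: 'a fract set set) \<lhd> finite_type_t_ideal \<longleftrightarrow>
      (proper_t_ideals :: 'a poly fract set set) \<lhd> finite_type_t_ideal"
    by (rule every_contained_in_poly_iff)
      (simp_all add: finite_type_poly_extension_iff unit_content_t_invertible(2))
  moreover have "(proper_t_ideals :: 'a fract set set) \<lhd> divisorial \<longleftrightarrow>
      (proper_t_ideals :: 'a poly fract set set) \<lhd> divisorial"
    by (rule every_contained_in_poly_iff)
      (simp_all add: divisorial_poly_extension_iff unit_content_t_invertible(3))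
  ultimately show ?thesis by blast
qed

end
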